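(* Let $K:\mathbb{R}^2\to\mathbb{R}$ be a measurable function satisfying $0<\lambda\le K\le\Lambda$ for constants $\lambda,\Lambda$. Let $u:\mathbb{R}^2\to\mathbb{R}$ be an entire solution of $$\Delta u+K e^{2u}=0$$ which is bounded from above. Then there exists $\epsilon>0$ such that $$\int_{B_R}e^{2u}\,dx=O(R^{2-\epsilon})\quad\text{as }R\to\infty.$$
   Context: An entire solution is a solution on all of $\mathbb{R}^2$. $B_R$ denotes the Euclidean disc of radius $R$ centered at the origin in $\mathbb{R}^2$. *)

theory Defs
  imports "HOL-Analysis.Analysis" "HOL-Library.Landau_Symbols"
begin

definition dir_deriv :: "'a \<Rightarrow> ('a \<Rightarrow> real) \<Rightarrow> 'a::euclidean_space \<Rightarrow> real" where
  "dir_deriv b f x = frechet_derivative f (at x) b"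

text \<open>
  \<open>C\<^sup>\<infinity>\<close> functions on the whole space: every iterated partial derivative (the list \<open>bs\<close> gives the
  directions, and \<open>bs = []\<close> is the function itself) is differentiable at every point.
  The value of \<open>frechet_derivative\<close> is unspecified at points of non-differentiability, but the
  condition for a list guarantees that the derivatives one order higher are genuine.
\<close>
definition smooth_fun :: "('a::euclidean_space \<Rightarrow> real) \<Rightarrow> bool" where
  "smooth_fun f \<longleftrightarrow> (\<forall>bs\<in>lists Basis. \<forall>x. foldr dir_deriv bs f differentiable at x)"

definition test_fun :: "('a::euclidean_space \<Rightarrow> real) \<Rightarrow> bool" where
  "test_fun \<phi> \<longleftrightarrow> smooth_fun \<phi> \<and> compact (closure {x. \<phi> x \<noteq> 0})"

definition laplacian :: "('a::euclidean_space \<Rightarrow> real) \<Rightarrow> 'a \<Rightarrow> real" where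
  "laplacian f x = (\<Sum>b\<in>Basis. dir_deriv b (dir_deriv b f) x)"

definition locally_integrable :: "('a::euclidean_space \<Rightarrow> real) \<Rightarrow> bool" where
  "locally_integrable f \<longleftrightarrow> (\<forall>S. compact S \<longrightarrow> f absolutely_integrable_on S)"

text \<open>
  Since \<open>K\<close> is only measurable, the equation \<open>\<Delta>u + K e\<^sup>2\<^sup>u = 0\<close> on the whole plane is
  understood in the sense of distributions.
\<close>
definition entire_solution :: "(real^2 \<Rightarrow> real) \<Rightarrow> (real^2 \<Rightarrow> real) \<Rightarrow> bool" where
  "entire_solution K u \<longleftrightarrow>
     locally_integrable u \<and>
     locally_integrable (\<lambda>x. K x * exp (2 * u x)) \<and>
     (\<forall>\<phi>. test_fun \<phi> \<longrightarrow>
        (LINT x|lebesgue. u x * laplacian \<phi> x)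
          + (LINT x|lebesgue. K x * exp (2 * u x) * \<phi> x) = 0)"

end

theory Submission
  imports Defs
begin

text \<open>
  Put \<open>w = M - u \<ge> 0\<close> with \<open>M\<close> an upper bound of \<open>u\<close>. Then \<open>\<Delta>w = f\<close> with \<open>0 \<le> f \<le> B exp (- 2 w)\<close>, so \<open>w\<close> is
  subharmonic with bounded Laplacian, and the Laplacian is tiny wherever \<open>w\<close> is large. As
  \<open>exp (2 u) \<le> f / l\<close>, it suffices to bound the mass that \<open>f\<close> puts on a disc. Two inequalities link
  this mass to averages of \<open>w\<close>.

  \<^item> As \<open>w \<ge> 0\<close>, the mass of a disc is at most a constant times the average of \<open>w\<close> over a larger
    concentric disc (\<open>avg_ge_mass\<close>).
  \<^item> For almost every \<open>y\<close>, the average of \<open>w\<close> over a disc about \<open>y\<close> is at most a constant times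
    \<open>w y\<close> plus a constant times the sum of the masses of the concentric discs obtained by repeated
    halving of the radius (\<open>avg_le_avg_small\<close>, \<open>AE_avg_le\<close>).

  Both come from a single smooth test function of compact support, whose Laplacian is the
  difference of the same bump at the scales \<open>s\<close> and \<open>s / 2\<close> (\<open>telescoping_kernel\<close>).

  They exclude quadratic growth (\<open>growth_contradiction\<close>). Fix \<open>l\<close> and let \<open>q < 4\<close> satisfy
  \<open>q ^ l = 4 ^ l - 1/2\<close>. Suppose that \<open>n\<close> is the first scale at which some cube of side \<open>2 ^ n\<close> has mass
  above \<open>A q ^ n\<close>. Its \<open>4 ^ l\<close> subcubes of side \<open>2 ^ (n - l)\<close> have mass at most \<open>A q ^ (n - l)\<close>
  each, and \<open>q\<close> is so close to 4 that every one of them must have at least half of this. So every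
  subcube contains a point where \<open>f\<close> is not exponentially small, that is, where \<open>w \<le> q ^ (n - l)\<close>. By the
  second inequality the average of \<open>w\<close> is \<open>O(A q ^ (n - l))\<close> over every subcube, hence over the
  whole cube; by the first one, so is the mass of a central subcube of side \<open>2 ^ (n - 5)\<close>. But
  this mass is at least \<open>A q ^ (n - 5) / 2\<close>, and the implied constants do not depend on \<open>l\<close>: a
  contradiction once \<open>l\<close> is large. Thus cubes of side \<open>2 ^ n\<close> have mass \<open>O(q ^ n)\<close>, and the theorem
  holds with \<open>\<epsilon> = 2 - log 2 q\<close>.
\<close>
section \<open>Smooth functions of one variable and radial functions\<close>

text \<open>
  The case \<open>p = 1\<close> is the classical smooth function that is flat at 0. Allowing a polynomial factor in
  \<open>1 / t\<close> makes the family closed under differentiation.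
\<close>
definition exp_tail :: "real poly \<Rightarrow> real \<Rightarrow> real" where
  "exp_tail p t = (if t > 0 then poly p (1 / t) * exp (- (1 / t)) else 0)"

lemma poly_times_exp_neg_tendsto_0:
  "((\<lambda>x. poly p x * exp (- x)) \<longlongrightarrow> (0::real)) at_top"
proof -
  have "((\<lambda>x. \<Sum>i\<le>degree p. coeff p i * (x ^ i / exp x)) \<longlongrightarrow> (\<Sum>i\<le>degree p. coeff p i * (0::real))) at_top"
    by (intro tendsto_intros tendsto_power_div_exp_0)
  then show ?thesis
    by (simp add: poly_altdef sum_distrib_right exp_minus divide_inverse mult.assoc)
qed

lemma exp_tail_derivative:
  "(exp_tail p has_real_derivative exp_tail (monom 1 2 * (p - pderiv p)) t) (at t)"
proof -
  consider "t > 0" | "t < 0" | "t = 0" by linarith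
  then show ?thesis
  proof cases
    case 1
    have "((\<lambda>t. poly p (1 / t) * exp (- (1 / t))) has_real_derivative
            exp_tail (monom 1 2 * (p - pderiv p)) t) (at t)"
      using 1 by (auto intro!: derivative_eq_intros DERIV_chain'[of _ _ _ _ "poly p"]
          simp: exp_tail_def poly_monom field_simps power2_eq_square)
    then show ?thesis
      by (rule has_field_derivative_transform_within[OF _ \<open>t > 0\<close>]) (auto simp: exp_tail_def dist_real_def)
  next
    case 2
    have "((\<lambda>t. 0) has_real_derivative exp_tail (monom 1 2 * (p - pderiv p)) t) (at t)"
      using 2 by (auto simp: exp_tail_def)
    then show ?thesis
      by (rule has_field_derivative_transform_within[where d = "-t"]) (use 2 in \<open>auto simp: exp_tail_def dist_real_def\<close>)
  next
    case 3
    have "((\<lambda>x. poly (pCons 0 p) x * exp (- x)) \<longlongrightarrow> (0::real)) at_top"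
      by (rule poly_times_exp_neg_tendsto_0)
    from filterlim_compose[OF this filterlim_inverse_at_top_right]
    have "((\<lambda>h. exp_tail p h / h) \<longlongrightarrow> 0) (at_right 0)"
      by (rule Lim_transform_eventually)
        (auto simp: eventually_at_filter exp_tail_def field_simps intro!: always_eventually)
    moreover have "((\<lambda>h. exp_tail p h / h) \<longlongrightarrow> 0) (at_left 0)"
      by (rule Lim_transform_eventually[OF tendsto_const])
        (auto simp: eventually_at_filter exp_tail_def)
    ultimately have "((\<lambda>h. exp_tail p h / h) \<longlongrightarrow> 0) (at 0)"
      using filterlim_split_at by blast
    then show ?thesis
      using 3 by (simp add: DERIV_def exp_tail_def)
  qed
qed

text \<open>
  A class of smooth functions on the line, generated by just the operations that the construction
  of the test function needs. As the derivative of a member is again a member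
  (\<open>smooth1_derivative\<close>), all members are infinitely differentiable. The rule for quotients covers the
  removable singularity of \<open>f t / t\<close> when \<open>f\<close> vanishes near 0.
\<close>
inductive smooth1 :: "(real \<Rightarrow> real) \<Rightarrow> bool" where
  smooth1_exp_tail: "smooth1 (exp_tail p)"
| smooth1_const: "smooth1 (\<lambda>_. c)"
| smooth1_add: "smooth1 f \<Longrightarrow> smooth1 g \<Longrightarrow> smooth1 (\<lambda>t. f t + g t)"
| smooth1_mult: "smooth1 f \<Longrightarrow> smooth1 g \<Longrightarrow> smooth1 (\<lambda>t. f t * g t)"
| smooth1_affine: "smooth1 f \<Longrightarrow> smooth1 (\<lambda>t. f (c * t + d))"
| smooth1_antiderivative: "(\<And>t. (F has_real_derivative f t) (at t)) \<Longrightarrow> smooth1 f \<Longrightarrow> smooth1 F"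
| smooth1_quotient: "smooth1 f \<Longrightarrow> 0 < \<delta> \<Longrightarrow> (\<And>t. \<bar>t\<bar> < \<delta> \<Longrightarrow> f t = 0) \<Longrightarrow> smooth1 (\<lambda>t. f t / t)"

lemma DERIV_zero_of_vanishing:
  fixes f :: "real \<Rightarrow> real"
  assumes "(f has_real_derivative D) (at t)" "\<And>t. \<bar>t\<bar> < \<delta> \<Longrightarrow> f t = 0" "\<bar>t\<bar> < \<delta>"
  shows "D = 0"
proof -
  have "((\<lambda>_. 0) has_real_derivative D) (at t)"
    by (rule has_field_derivative_transform_within[OF assms(1), where d = "\<delta> - \<bar>t\<bar>"])
      (use assms(2,3) in \<open>auto simp: dist_real_def\<close>)
  then show ?thesis
    using DERIV_const DERIV_unique by blast
qed

lemma smooth1_derivative: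
  assumes "smooth1 f"
  shows "\<exists>f'. smooth1 f' \<and> (\<forall>t. (f has_real_derivative f' t) (at t))"
  using assms
proof (induction rule: smooth1.induct)
  case (smooth1_exp_tail p)
  then show ?case using exp_tail_derivative smooth1.smooth1_exp_tail by blast
next
  case (smooth1_const c)
  then show ?case using smooth1.smooth1_const DERIV_const by blast
next
  case (smooth1_add f g)
  then obtain f' g' where "smooth1 f'" "smooth1 g'"
    "\<forall>t. (f has_real_derivative f' t) (at t)" "\<forall>t. (g has_real_derivative g' t) (at t)"
    by blast
  then show ?case
    by (intro exI[of _ "\<lambda>t. f' t + g' t"])
      (auto intro: smooth1.smooth1_add intro!: derivative_eq_intros)
next
  case (smooth1_mult f g)
  then obtain f' g' where "smooth1 f'" "smooth1 g'"
    "\<And>t. (f has_real_derivative f' t) (at t)" "\<And>t. (g has_real_derivative g' t) (at t)"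
    by blast
  then show ?case using smooth1_mult.hyps
    by (intro exI[of _ "\<lambda>t. f' t * g t + f t * g' t"])
      (auto intro!: smooth1.smooth1_add smooth1.smooth1_mult derivative_eq_intros)
next
  case (smooth1_affine f c d)
  then obtain f' where f': "smooth1 f'" "\<And>t. (f has_real_derivative f' t) (at t)" by blast
  have "((\<lambda>t. f (c * t + d)) has_real_derivative c * f' (c * t + d)) (at t)" for t
  proof -
    have "((\<lambda>t. c * t + d) has_real_derivative c) (at t)"
      by (auto intro!: derivative_eq_intros)
    from DERIV_chain'[OF this f'(2)] show ?thesis by (simp add: mult.commute)
  qed
  moreover have "smooth1 (\<lambda>t. c * f' (c * t + d))"
    by (intro smooth1.smooth1_mult[OF smooth1.smooth1_const] smooth1.smooth1_affine f'(1))
  ultimately show ?case by blast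
next
  case (smooth1_antiderivative F f)
  then show ?case by blast
next
  case (smooth1_quotient f \<delta>)
  then obtain f' where f': "smooth1 f'" "\<And>t. (f has_real_derivative f' t) (at t)" by blast
  have f'0: "f' t = 0" if "\<bar>t\<bar> < \<delta>" for t
    using DERIV_zero_of_vanishing[OF f'(2) smooth1_quotient.hyps(3) that] by simp
  \<comment> \<open>the quotient rule, written so that each summand is itself a quotient of this kind\<close>
  let ?D = "\<lambda>t. f' t / t + (-1) * ((f t / t) / t)"
  have "smooth1 ?D"
  proof (intro smooth1.smooth1_add smooth1.smooth1_mult smooth1.smooth1_const)
    show "smooth1 (\<lambda>t. f' t / t)"
      by (rule smooth1.smooth1_quotient[OF f'(1) smooth1_quotient.hyps(2) f'0])
    show "smooth1 (\<lambda>t. f t / t / t)"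
      by (rule smooth1.smooth1_quotient[OF _ smooth1_quotient.hyps(2)])
        (use smooth1_quotient.hyps smooth1.smooth1_quotient in auto)
  qed
  moreover have "((\<lambda>t. f t / t) has_real_derivative ?D t) (at t)" for t
  proof (cases "t = 0")
    case True
    have "((\<lambda>t. 0) has_real_derivative ?D t) (at t)"
      using True by auto
    then show ?thesis
      by (rule has_field_derivative_transform_within[OF _ smooth1_quotient.hyps(2)])
        (use smooth1_quotient.hyps(3) True in \<open>auto simp: dist_real_def\<close>)
  next
    case False
    then show ?thesis
      by (auto intro!: derivative_eq_intros f'(2) simp: field_simps)
  qed
  ultimately show ?case by blast
qed

lemma smooth1_continuous: "smooth1 f \<Longrightarrow> isCont f t"
  using smooth1_derivative DERIV_isCont by blast

lemma smooth1_has_antiderivative: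
  assumes "smooth1 f"
  obtains F where "smooth1 F" "\<And>t. (F has_real_derivative f t) (at t)"
proof -
  obtain F where "\<And>t. (F has_real_derivative f t) (at t)"
    using einterval_antiderivative[of "-\<infinity>" "\<infinity>" f] smooth1_continuous[OF assms]
    by (auto simp: has_real_derivative_iff_has_vector_derivative)
  then show thesis using that smooth1_antiderivative assms by blast
qed

text \<open>
  The same device in several variables: the class is closed under every \<open>dir_deriv b\<close>, so that
  all iterated partial derivatives of a member exist.
\<close>
inductive smooth_class :: "('a::euclidean_space \<Rightarrow> real) \<Rightarrow> bool" where
  smooth_class_const: "smooth_class (\<lambda>_. c)"
| smooth_class_inner: "smooth_class (\<lambda>x. x \<bullet> b)"
| smooth_class_add: "smooth_class f \<Longrightarrow> smooth_class g \<Longrightarrow> smooth_class (\<lambda>x. f x + g x)"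
| smooth_class_mult: "smooth_class f \<Longrightarrow> smooth_class g \<Longrightarrow> smooth_class (\<lambda>x. f x * g x)"
| smooth_class_compose: "smooth1 h \<Longrightarrow> smooth_class f \<Longrightarrow> smooth_class (\<lambda>x. h (f x))"

lemma dir_deriv_eq:
  assumes "(f has_derivative f') (at x)"
  shows "dir_deriv b f x = f' b"
  using frechet_derivative_at[OF assms] by (simp add: dir_deriv_def)

lemma smooth_class_derivative:
  assumes "smooth_class f"
  shows "(\<forall>x. f differentiable at x) \<and> (\<forall>b. smooth_class (dir_deriv b f))"
  using assms
proof (induction rule: smooth_class.induct)
  case (smooth_class_const c)
  have "dir_deriv b (\<lambda>_. c) = (\<lambda>x::'a. 0)" for b
    by (rule ext, subst dir_deriv_eq[OF has_derivative_const]) simp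
  then show ?case by (auto intro: smooth_class.smooth_class_const)
next
  case (smooth_class_inner c)
  have d: "((\<lambda>x. x \<bullet> c) has_derivative (\<lambda>h. h \<bullet> c)) (at x)" for x :: 'a
    by (auto intro!: derivative_eq_intros)
  then have "dir_deriv b (\<lambda>x. x \<bullet> c) = (\<lambda>x::'a. b \<bullet> c)" for b
    using dir_deriv_eq by blast
  then show ?case using d by (auto intro: smooth_class.smooth_class_const simp: differentiable_def)
next
  case (smooth_class_add f g)
  then have d: "(f has_derivative frechet_derivative f (at x)) (at x)"
    "(g has_derivative frechet_derivative g (at x)) (at x)" for x
    using frechet_derivative_works by blast+
  have "dir_deriv b (\<lambda>x. f x + g x) = (\<lambda>x. dir_deriv b f x + dir_deriv b g x)" for b
    by (rule ext, subst dir_deriv_eq[OF has_derivative_add[OF d]]) (simp add: dir_deriv_def)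
  then show ?case using smooth_class_add by (auto intro: smooth_class.smooth_class_add)
next
  case (smooth_class_mult f g)
  then have d: "(f has_derivative frechet_derivative f (at x)) (at x)"
    "(g has_derivative frechet_derivative g (at x)) (at x)" for x
    using frechet_derivative_works by blast+
  have "dir_deriv b (\<lambda>x. f x * g x) = (\<lambda>x. f x * dir_deriv b g x + dir_deriv b f x * g x)" for b
    by (rule ext, subst dir_deriv_eq[OF has_derivative_mult[OF d]]) (simp add: dir_deriv_def)
  moreover have "smooth_class (\<lambda>x. f x * dir_deriv b g x + dir_deriv b f x * g x)" for b
    by (intro smooth_class.smooth_class_add smooth_class.smooth_class_mult) (use smooth_class_mult in auto)
  moreover have "(\<lambda>x. f x * g x) differentiable at x" for x
    using smooth_class_mult by auto
  ultimately show ?case by simp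
next
  case (smooth_class_compose h f)
  then have d: "(f has_derivative frechet_derivative f (at x)) (at x)" for x
    using frechet_derivative_works by blast
  obtain h' where h': "smooth1 h'" "\<And>t. (h has_real_derivative h' t) (at t)"
    using smooth1_derivative smooth_class_compose.hyps by blast
  have dh: "((\<lambda>x. h (f x)) has_derivative (\<lambda>v. h' (f x) * frechet_derivative f (at x) v)) (at x)" for x
    using has_derivative_compose[OF d h'(2)[unfolded has_field_derivative_def]] by simp
  have "dir_deriv b (\<lambda>x. h (f x)) = (\<lambda>x. h' (f x) * dir_deriv b f x)" for b
    by (rule ext, subst dir_deriv_eq[OF dh]) (simp add: dir_deriv_def)
  moreover have "smooth_class (\<lambda>x. h' (f x) * dir_deriv b f x)" for b
    by (rule smooth_class.smooth_class_mult[OF smooth_class.smooth_class_compose[OF h'(1)]])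
      (use smooth_class_compose in auto)
  ultimately show ?case using dh by (auto simp: differentiable_def)
qed

lemma smooth_class_imp_smooth_fun:
  assumes "smooth_class f"
  shows "smooth_fun f"
proof -
  have "smooth_class (foldr dir_deriv bs f)" for bs
    by (induction bs) (use assms smooth_class_derivative in auto)
  then show ?thesis
    using smooth_class_derivative by (auto simp: smooth_fun_def)
qed

lemma smooth_class_sum:
  "finite I \<Longrightarrow> (\<And>i. i \<in> I \<Longrightarrow> smooth_class (f i)) \<Longrightarrow> smooth_class (\<lambda>x. \<Sum>i\<in>I. f i x)"
  by (induction I rule: finite_induct) (auto intro: smooth_class.intros)

lemma smooth_class_norm_sq:
  "smooth_class (\<lambda>x::'a::euclidean_space. (norm (x - y))\<^sup>2)"
proof -
  have "(norm (x - y))\<^sup>2 = (\<Sum>b\<in>Basis. (x \<bullet> b + - (y \<bullet> b)) * (x \<bullet> b + - (y \<bullet> b)))" for x :: 'a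
    unfolding power2_norm_eq_inner by (subst euclidean_inner) (simp add: inner_diff_left)
  then show ?thesis
    by (simp only:) (intro smooth_class_sum smooth_class.intros finite_Basis)
qed

text \<open>
  Two is the dimension in which the Laplacian is a total derivative in the variable \<open>t = p |x - y|\<^sup>2\<close>,
  namely \<open>4 p (t N')'\<close>; so a radial function with prescribed Laplacian is found by integrating twice.
\<close>
lemma laplacian_radial:
  fixes y :: "real^2"
  assumes N: "\<And>t. (N has_real_derivative N1 t) (at t)" "\<And>t. (N1 has_real_derivative N2 t) (at t)"
  shows "laplacian (\<lambda>x. N (p * (norm (x - y))\<^sup>2)) x
       = 4 * p * (N1 (p * (norm (x - y))\<^sup>2) + p * (norm (x - y))\<^sup>2 * N2 (p * (norm (x - y))\<^sup>2))"
proof -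
  let ?q = "\<lambda>x. p * (norm (x - y))\<^sup>2"
  have q: "(?q has_derivative (\<lambda>h. 2 * p * ((x - y) \<bullet> h))) (at x)" for x
    unfolding power2_norm_eq_inner
    by (auto intro!: derivative_eq_intros simp: inner_commute algebra_simps)
  have 1: "((\<lambda>x. N (?q x)) has_derivative (\<lambda>h. N1 (?q x) * (2 * p * ((x - y) \<bullet> h)))) (at x)" for x
    using has_derivative_compose[OF q N(1)[unfolded has_field_derivative_def]] by simp
  have N1: "((\<lambda>x. N1 (?q x)) has_derivative (\<lambda>h. N2 (?q x) * (2 * p * ((x - y) \<bullet> h)))) (at x)" for x
    using has_derivative_compose[OF q N(2)[unfolded has_field_derivative_def]] by simp
  have d1: "dir_deriv b (\<lambda>x. N (?q x)) = (\<lambda>x. N1 (?q x) * (2 * p * ((x - y) \<bullet> b)))" for b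
    using dir_deriv_eq[OF 1] by blast
  have 2: "((\<lambda>x. N1 (?q x) * (2 * p * ((x - y) \<bullet> b))) has_derivative
      (\<lambda>h. N1 (?q x) * (2 * p * (h \<bullet> b)) + N2 (?q x) * (2 * p * ((x - y) \<bullet> h)) * (2 * p * ((x - y) \<bullet> b)))) (at x)" for b
    by (rule has_derivative_eq_rhs, rule has_derivative_mult[OF N1]) (auto intro!: derivative_eq_intros)
  have "laplacian (\<lambda>x. N (?q x)) x = (\<Sum>b\<in>Basis. 2 * p * N1 (?q x) + 4 * p * p * N2 (?q x) * (((x - y) \<bullet> b) * ((x - y) \<bullet> b)))"
    unfolding laplacian_def
    by (rule sum.cong[OF refl], subst d1, subst dir_deriv_eq[OF 2]) (simp add: inner_same_Basis algebra_simps)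
  also have "\<dots> = 4 * p * N1 (?q x) + 4 * p * p * N2 (?q x) * ((x - y) \<bullet> (x - y))"
    by (subst euclidean_inner[of "x - y" "x - y"])
       (simp add: sum.distrib sum_distrib_left del: inner_diff_left inner_diff_right)
  finally show ?thesis
    unfolding power2_norm_eq_inner by (simp add: algebra_simps)
qed

section \<open>A test function whose Laplacian telescopes\<close>

text \<open>
  The step \<open>\<psi>\<close> is a normalised antiderivative of a product of two exponential tails, one vanishing to
  the left of \<open>1/4\<close> and one to the right of 1.
\<close>
lemma smooth_cutoff:
  obtains \<psi> \<beta> where
    "smooth1 \<psi>" "smooth1 \<beta>" "\<And>t. (\<psi> has_real_derivative - \<beta> t) (at t)" "\<And>t. 0 \<le> \<beta> t"
    "\<And>t. t \<le> 1/4 \<Longrightarrow> \<beta> t = 0" "\<And>t. 1 \<le> t \<Longrightarrow> \<beta> t = 0"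
    "\<And>t. t \<le> 1/4 \<Longrightarrow> \<psi> t = 1" "\<And>t. 1 \<le> t \<Longrightarrow> \<psi> t = 0" "\<And>t. 0 \<le> \<psi> t"
proof -
  let ?e = "exp_tail 1"
  define b where "b = (\<lambda>t. ?e (1 * t + (- 1/4)) * ?e ((- 1) * t + 1))"
  have sb: "smooth1 b"
    unfolding b_def by (intro smooth1_mult smooth1_affine[OF smooth1_exp_tail])
  then obtain B where B: "smooth1 B" "\<And>t. (B has_real_derivative b t) (at t)"
    using smooth1_has_antiderivative by blast
  have b0: "0 \<le> b t" for t by (auto simp: b_def exp_tail_def)
  have bpos: "0 < b t" if "1/4 < t" "t < 1" for t using that by (auto simp: b_def exp_tail_def)
  have bout: "b t = 0" if "t \<le> 1/4 \<or> 1 \<le> t" for t using that by (auto simp: b_def exp_tail_def)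
  have mono: "B s \<le> B t" if "s \<le> t" for s t
    by (rule DERIV_nonneg_imp_nondecreasing[OF that]) (use B b0 in blast)
  have Blow: "B t = B (1/4)" if "t \<le> 1/4" for t
  proof -
    have "B (1/4) \<le> B t"
    proof (rule DERIV_nonpos_imp_nonincreasing[OF that])
      show "\<exists>y. DERIV B x :> y \<and> y \<le> 0" if "t \<le> x" "x \<le> 1/4" for x
        by (intro exI[of _ "b x"] conjI B(2)) (use bout that in auto)
    qed
    then show ?thesis using mono[OF that] by simp
  qed
  have Bhigh: "B t = B 1" if "1 \<le> t" for t
  proof -
    have "B t \<le> B 1"
    proof (rule DERIV_nonpos_imp_nonincreasing[OF that])
      show "\<exists>y. DERIV B x :> y \<and> y \<le> 0" if "1 \<le> x" for x
        by (intro exI[of _ "b x"] conjI B(2)) (use bout that in auto)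
    qed
    then show ?thesis using mono[OF that] by simp
  qed
  have strict: "B (1/4) < B 1"
  proof (rule DERIV_pos_imp_increasing_open[of "1/4" 1 B])
    show "continuous_on {1/4..1} B"
      by (intro continuous_at_imp_continuous_on ballI smooth1_continuous B(1))
  qed (use B(2) bpos in auto)
  define I where "I = B 1 - B (1/4)"
  have I: "0 < I" using strict by (simp add: I_def)
  define \<psi> where "\<psi> = (\<lambda>t. (- 1 / I) * B t + B 1 / I)"
  define \<beta> where "\<beta> = (\<lambda>t. (1 / I) * b t)"
  show thesis
  proof
    show "smooth1 \<psi>" unfolding \<psi>_def by (intro smooth1_add smooth1_mult[OF smooth1_const] smooth1_const B)
    show "smooth1 \<beta>" unfolding \<beta>_def by (intro smooth1_mult[OF smooth1_const] sb)
    show "(\<psi> has_real_derivative - \<beta> t) (at t)" for t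
      unfolding \<psi>_def \<beta>_def using I by (auto intro!: derivative_eq_intros B(2))
    show "0 \<le> \<beta> t" for t using b0 I by (simp add: \<beta>_def)
    show "\<beta> t = 0" if "t \<le> 1/4" for t using bout that by (simp add: \<beta>_def)
    show "\<beta> t = 0" if "1 \<le> t" for t using bout that by (simp add: \<beta>_def)
    show "\<psi> t = 1" if "t \<le> 1/4" for t
    proof -
      have "\<psi> t = (B 1 - B (1/4)) / I" using Blow[OF that] by (simp add: \<psi>_def diff_divide_distrib)
      then show ?thesis using I by (simp add: I_def)
    qed
    show "\<psi> t = 0" if "1 \<le> t" for t
      using Bhigh[OF that] I by (simp add: \<psi>_def field_simps)
    show "0 \<le> \<psi> t" for t
    proof -
      have "B t \<le> B 1" using mono[of t 1] Bhigh[of t] by (cases "t \<le> 1") auto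
      then show ?thesis using I by (simp add: \<psi>_def field_simps)
    qed
  qed
qed

text \<open>
  In the variable \<open>t = |x - y|\<^sup>2 / s\<^sup>2\<close> the Laplacian of \<open>N t\<close> is \<open>4 (t N')' / s\<^sup>2\<close>, so the required
  identity is \<open>4 (t N')' = a t - 4 a (4 t)\<close>. With \<open>a = - g'\<close> it integrates to
  \<open>4 t N' = - (g t - g (4 t))\<close>, which determines \<open>N\<close> from \<open>g\<close>; the right-hand side vanishes
  for \<open>t \<ge> 1\<close> if \<open>g\<close> does. The choice \<open>g t = (1 - t) \<psi> t\<close> is smooth and nonincreasing, and linear rather
  than constant near 0, so that \<open>a\<close> is bounded below near the centre of the disc.
\<close>
lemma telescoping_kernel:
  obtains a N :: "real \<Rightarrow> real" and c C :: real where
    "0 < c" "c \<le> 1" "1 \<le> C"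
    "\<And>t. isCont a t" "\<And>t. isCont N t"
    "\<And>t. 0 \<le> a t" "\<And>t. a t \<le> C" "\<And>t. 1 \<le> t \<Longrightarrow> a t = 0" "\<And>t. t \<le> 1/4 \<Longrightarrow> c \<le> a t"
    "\<And>t. 0 \<le> t \<Longrightarrow> 0 \<le> N t" "\<And>t. 0 \<le> t \<Longrightarrow> N t \<le> C"
    "\<And>t. 1 \<le> t \<Longrightarrow> N t = 0" "\<And>t. 0 \<le> t \<Longrightarrow> t \<le> 1/64 \<Longrightarrow> c \<le> N t"
    "\<And>(y::real^2) s. 0 < s \<Longrightarrow> test_fun (\<lambda>x. N ((norm (x - y) / s)\<^sup>2))"
    "\<And>(y::real^2) s x. 0 < s \<Longrightarrow> laplacian (\<lambda>x. N ((norm (x - y) / s)\<^sup>2)) x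
        = a ((norm (x - y) / s)\<^sup>2) / s\<^sup>2 - a ((norm (x - y) / (s/2))\<^sup>2) / (s/2)\<^sup>2"
proof -
  obtain \<psi> \<beta> where
    smooth: "smooth1 \<psi>" "smooth1 \<beta>" and deriv: "\<And>t. (\<psi> has_real_derivative - \<beta> t) (at t)"
    and \<beta>: "\<And>t. 0 \<le> \<beta> t" "\<And>t. t \<le> 1/4 \<Longrightarrow> \<beta> t = 0" "\<And>t. 1 \<le> t \<Longrightarrow> \<beta> t = 0"
    and \<psi>: "\<And>t. t \<le> 1/4 \<Longrightarrow> \<psi> t = 1" "\<And>t. 1 \<le> t \<Longrightarrow> \<psi> t = 0" "\<And>t. 0 \<le> \<psi> t"
    using smooth_cutoff by metis
  define g where "g = (\<lambda>t. (1 - t) * \<psi> t)"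
  define a where "a = (\<lambda>t. \<psi> t + (1 - t) * \<beta> t)"
  have g': "(g has_real_derivative - a t) (at t)" for t
    unfolding g_def a_def by (auto intro!: derivative_eq_intros deriv simp: algebra_simps)
  have a_nonneg: "0 \<le> a t" for t
    using \<psi>(3) \<beta>(1,3) by (cases "t \<le> 1") (auto simp: a_def)
  have a_out: "a t = 0" if "1 \<le> t" for t using \<psi> \<beta> that by (simp add: a_def)
  have a_in: "a t = 1" if "t \<le> 1/4" for t using \<psi> \<beta> that by (simp add: a_def)
  have a_cont: "isCont a t" for t
    unfolding a_def using smooth by (intro continuous_intros smooth1_continuous)
  have g_anti: "g t \<le> g s" if "s \<le> t" for s t
  proof (rule DERIV_nonpos_imp_nonincreasing[OF that])
    show "\<exists>y. DERIV g x :> y \<and> y \<le> 0" for x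
      by (intro exI[of _ "- a x"] conjI g') (use a_nonneg in auto)
  qed
  \<comment> \<open>\<open>r = - N'\<close>, that is \<open>(g t - g (4 t)) / (4 t)\<close> with the factor \<open>t\<close> cancelled where it
    occurs; the numerator of the remaining quotient vanishes near 0\<close>
  define r where "r = (\<lambda>t. (1/4) * ((\<psi> t + (-1) * \<psi> (4 * t + 0)) / t) + (-1/4) * \<psi> t + \<psi> (4 * t + 0))"
  have r_smooth: "smooth1 r"
    unfolding r_def
  proof (intro smooth1_add smooth1_mult[OF smooth1_const] smooth1_affine[OF smooth(1)] smooth)
    show "smooth1 (\<lambda>t. (\<psi> t + (-1) * \<psi> (4 * t + 0)) / t)"
    proof (rule smooth1_quotient[where \<delta> = "1/16"])
      show "smooth1 (\<lambda>t. \<psi> t + (-1) * \<psi> (4 * t + 0))"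
        by (intro smooth1_add smooth1_mult[OF smooth1_const] smooth1_affine[OF smooth(1)] smooth)
    qed (use \<psi>(1) in \<open>auto simp: abs_if split: if_splits\<close>)
  qed
  have r_eq: "4 * (t * r t) = g t - g (4 * t)" for t
    by (cases "t = 0") (auto simp: r_def g_def field_simps)
  have r_nonneg: "0 \<le> r t" if "0 \<le> t" for t
  proof (cases "t = 0")
    case True then show ?thesis using \<psi>(1) by (simp add: r_def)
  next
    case False
    have "0 \<le> 4 * (t * r t)" unfolding r_eq using g_anti[of t "4 * t"] that by simp
    then show ?thesis using False that by (simp add: zero_le_mult_iff)
  qed
  have r_out: "r t = 0" if "1 \<le> t" for t using \<psi>(2) that by (simp add: r_def)
  have r_in: "r t = 3/4" if "0 < t" "t \<le> 1/16" for t using \<psi>(1) that by (simp add: r_def)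
  obtain F where F: "smooth1 F" "\<And>t. (F has_real_derivative r t) (at t)"
    using smooth1_has_antiderivative[OF r_smooth] by blast
  define N where "N = (\<lambda>t. F 1 + (-1) * F t)"
  have N_smooth: "smooth1 N"
    unfolding N_def by (intro smooth1_add smooth1_mult[OF smooth1_const] smooth1_const F)
  have N': "(N has_real_derivative - r t) (at t)" for t
    unfolding N_def by (auto intro!: derivative_eq_intros F(2))
  have N_anti: "N t \<le> N s" if "0 \<le> s" "s \<le> t" for s t
  proof (rule DERIV_nonpos_imp_nonincreasing[OF that(2)])
    show "\<exists>y. DERIV N x :> y \<and> y \<le> 0" if "s \<le> x" for x
      by (intro exI[of _ "- r x"] conjI N') (use r_nonneg[of x] that \<open>0 \<le> s\<close> in auto)
  qed
  have N_out: "N t = 0" if "1 \<le> t" for t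
  proof -
    have "N 1 \<le> N t"
    proof (rule DERIV_nonneg_imp_nondecreasing[OF that])
      show "\<exists>y. DERIV N x :> y \<and> 0 \<le> y" if "1 \<le> x" for x
        using N'[of x] r_out[OF that] by auto
    qed
    then show ?thesis using N_anti[of 1 t] that by (simp add: N_def)
  qed
  have N_nonneg: "0 \<le> N t" if "0 \<le> t" for t
    using N_anti[of t 1] N_out[of t] N_out[of 1] that by (cases "t \<le> 1") auto
  have N_pos: "0 < N (1/64)"
  proof -
    have "N (1/16) < N (1/64)"
    proof (rule DERIV_neg_imp_decreasing[of "1/64" "1/16" N])
      show "\<exists>y. DERIV N x :> y \<and> y < 0" if "1/64 \<le> x" "x \<le> 1/16" for x
        by (intro exI[of _ "- r x"] conjI N') (use r_in[of x] that in auto)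
    qed simp
    then show ?thesis using N_nonneg[of "1/16"] by linarith
  qed
  obtain r' where r': "smooth1 r'" "\<And>t. (r has_real_derivative r' t) (at t)"
    using smooth1_derivative[OF r_smooth] by blast
  have ar: "4 * (r t + t * r' t) = - a t + 4 * a (4 * t)" for t
  proof -
    have "((\<lambda>t. 4 * (t * r t)) has_real_derivative 4 * (r t + t * r' t)) (at t)"
      by (auto intro!: derivative_eq_intros r'(2))
    moreover have "((\<lambda>t. g (4 * t)) has_real_derivative - a (4 * t) * 4) (at t)"
      by (rule DERIV_chain'[of "\<lambda>t. 4 * t" _ _ _ g, THEN DERIV_cong])
        (auto intro!: derivative_eq_intros g')
    then have "((\<lambda>t. g t - g (4 * t)) has_real_derivative - a t - (- a (4 * t) * 4)) (at t)"
      by (intro DERIV_diff g')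
    ultimately have "4 * (r t + t * r' t) = - a t - (- a (4 * t) * 4)"
      unfolding r_eq by (rule DERIV_unique)
    then show ?thesis by simp
  qed
  obtain M where M: "\<And>t. t \<in> {1/4..1} \<Longrightarrow> a t \<le> M"
  proof -
    have "continuous_on {1/4..1} a"
      by (intro continuous_at_imp_continuous_on ballI a_cont)
    from continuous_attains_sup[OF _ _ this] show thesis using that by fastforce
  qed
  define C where "C = max 1 (max M (N 0))"
  define c where "c = min 1 (N (1/64))"
  show thesis
  proof (rule that[of c C a N])
    show "0 < c" "c \<le> 1" "1 \<le> C" using N_pos by (auto simp: c_def C_def)
    show "isCont N t" for t using smooth1_continuous[OF N_smooth] .
    show "a t \<le> C" for t
    proof -
      consider "t \<le> 1/4" | "t \<in> {1/4..1}" | "1 \<le> t" unfolding atLeastAtMost_iff by linarith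
      then show ?thesis using a_in[of t] a_out[of t] M[of t] by cases (auto simp: C_def)
    qed
    show "c \<le> a t" if "t \<le> 1/4" for t using a_in[OF that] by (simp add: c_def)
    show "N t \<le> C" if "0 \<le> t" for t using N_anti[of 0 t] that by (simp add: C_def)
    show "c \<le> N t" if "0 \<le> t" "t \<le> 1/64" for t using N_anti[OF that] by (simp add: c_def)
  next
    fix y x :: "real^2" and s :: real assume s: "0 < s"
    have eq: "(norm (x - y) / s)\<^sup>2 = (1/s\<^sup>2) * (norm (x - y))\<^sup>2" for x by (simp add: power_divide)
    have smooth: "smooth_fun (\<lambda>x. N ((norm (x - y) / s)\<^sup>2))"
      unfolding eq
      by (intro smooth_class_imp_smooth_fun smooth_class_compose[OF N_smooth]
          smooth_class_mult[OF smooth_class_const] smooth_class_norm_sq)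
    have "closure {x. N ((norm (x - y) / s)\<^sup>2) \<noteq> 0} \<subseteq> cball y s"
    proof (rule closure_minimal)
      show "{x. N ((norm (x - y) / s)\<^sup>2) \<noteq> 0} \<subseteq> cball y s"
      proof clarsimp
        fix x assume "N ((norm (x - y) / s)\<^sup>2) \<noteq> 0"
        then have "(norm (x - y) / s)\<^sup>2 < 1" using N_out not_le by blast
        then have "norm (x - y) / s < 1" using power2_less_imp_less[of "norm (x - y) / s" 1] by simp
        then show "dist y x \<le> s" using s by (simp add: dist_norm norm_minus_commute)
      qed
    qed simp
    then have "compact (closure {x. N ((norm (x - y) / s)\<^sup>2) \<noteq> 0})"
      by (simp add: compact_eq_bounded_closed bounded_subset[OF bounded_cball])
    with smooth show "test_fun (\<lambda>x. N ((norm (x - y) / s)\<^sup>2))"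
      unfolding test_fun_def by blast
    have r'': "((\<lambda>t. - r t) has_real_derivative - r' t) (at t)" for t
      by (intro DERIV_minus r'(2))
    let ?t = "(norm (x - y) / s)\<^sup>2"
    have eq4: "(norm (x - y) / (s/2))\<^sup>2 = 4 * ?t" by (simp add: power_divide)
    have "laplacian (\<lambda>x. N ((norm (x - y) / s)\<^sup>2)) x = - (1/s\<^sup>2) * (4 * (r ?t + ?t * r' ?t))"
      unfolding eq by (subst laplacian_radial[OF N' r'']) (simp add: algebra_simps)
    also have "\<dots> = a ?t / s\<^sup>2 - a ((norm (x - y) / (s/2))\<^sup>2) / (s/2)\<^sup>2"
      unfolding ar eq4 using s by (simp add: field_simps)
    finally show "laplacian (\<lambda>x. N ((norm (x - y) / s)\<^sup>2)) x
        = a ?t / s\<^sup>2 - a ((norm (x - y) / (s/2))\<^sup>2) / (s/2)\<^sup>2" .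
  qed (fact a_cont a_nonneg a_out N_nonneg N_out)+
qed

section \<open>Bump averages of a locally integrable function\<close>

text \<open>
  Borel densities of measures that are finite on bounded sets. Both \<open>w\<close> and \<open>f\<close> are of this kind.
\<close>
definition loc_density :: "('a::euclidean_space \<Rightarrow> real) \<Rightarrow> bool" where
  "loc_density g \<longleftrightarrow> g \<in> borel_measurable borel \<and> (\<forall>x. 0 \<le> g x) \<and>
     (\<forall>S\<in>sets borel. bounded S \<longrightarrow> set_integrable lborel S g)"

lemma loc_densityD:
  assumes "loc_density g"
  shows "g \<in> borel_measurable borel" "0 \<le> g x"
    "S \<in> sets borel \<Longrightarrow> bounded S \<Longrightarrow> set_integrable lborel S g"
  using assms by (auto simp: loc_density_def)

lemma loc_densityI:
  assumes "g \<in> borel_measurable borel" "\<And>x. 0 \<le> g x" "\<And>r. set_integrable lborel (cball 0 r) g"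
  shows "loc_density g"
  unfolding loc_density_def
proof (intro conjI ballI allI impI assms)
  fix S :: "'a set" assume S: "S \<in> sets borel" "bounded S"
  then obtain r where "\<And>x. x \<in> S \<Longrightarrow> norm x \<le> r" by (auto simp: bounded_iff)
  then have "S \<subseteq> cball 0 r" by auto
  then show "set_integrable lborel S g"
    using set_integrable_subset[OF assms(3)] S by auto
qed

lemma loc_density_mass_nonneg:
  "loc_density g \<Longrightarrow> 0 \<le> (LINT x:S|lborel. g x)"
  by (auto simp: set_lebesgue_integral_def loc_density_def intro!: integral_nonneg)

lemma loc_density_mass_le_sum:
  assumes g: "loc_density g" and I: "finite I"
    and Q: "Q \<in> sets borel" "bounded Q" "Q \<subseteq> (\<Union>i\<in>I. P i)"
    and P: "\<And>i. i \<in> I \<Longrightarrow> P i \<in> sets borel" "\<And>i. i \<in> I \<Longrightarrow> bounded (P i)"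
  shows "(LINT x:Q|lborel. g x) \<le> (\<Sum>i\<in>I. LINT x:P i|lborel. g x)"
proof -
  have int: "integrable lborel (\<lambda>x. indicator (P i) x *\<^sub>R g x)" if "i \<in> I" for i
    using loc_densityD(3)[OF g P(1,2)] that by (simp add: set_integrable_def)
  have "(LINT x:Q|lborel. g x) \<le> (LINT x|lborel. (\<Sum>i\<in>I. indicator (P i) x *\<^sub>R g x))"
    unfolding set_lebesgue_integral_def
  proof (rule integral_mono)
    show "integrable lborel (\<lambda>x. indicator Q x *\<^sub>R g x)"
      using loc_densityD(3)[OF g Q(1,2)] by (simp add: set_integrable_def)
    show "integrable lborel (\<lambda>x. \<Sum>i\<in>I. indicator (P i) x *\<^sub>R g x)"
      using int by auto
    show "indicator Q x *\<^sub>R g x \<le> (\<Sum>i\<in>I. indicator (P i) x *\<^sub>R g x)" for x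
    proof (cases "x \<in> Q")
      case True
      then obtain i where i: "i \<in> I" "x \<in> P i" using Q(3) by blast
      have "indicator (P i) x *\<^sub>R g x \<le> (\<Sum>i\<in>I. indicator (P i) x *\<^sub>R g x)"
        by (rule member_le_sum[OF i(1)]) (use I loc_densityD(2)[OF g] in auto)
      then show ?thesis using True i by simp
    qed (auto intro!: sum_nonneg mult_nonneg_nonneg loc_densityD(2)[OF g])
  qed
  also have "\<dots> = (\<Sum>i\<in>I. LINT x:P i|lborel. g x)"
    unfolding set_lebesgue_integral_def by (rule Bochner_Integration.integral_sum) (use int in auto)
  finally show ?thesis .
qed

lemma loc_density_mass_mono:
  assumes "loc_density g" "Q \<in> sets borel" "P \<in> sets borel" "bounded P" "Q \<subseteq> P"
  shows "(LINT x:Q|lborel. g x) \<le> (LINT x:P|lborel. g x)"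
  using loc_density_mass_le_sum[OF assms(1), of "{()}" Q "\<lambda>_. P"] assms bounded_subset by auto

text \<open>
  Lebesgue differentiation over cubes that shrink to one of their corners.
\<close>
lemma AE_nonneg_if_cube_integrals_nonneg:
  fixes g :: "'a::euclidean_space \<Rightarrow> real"
  assumes int: "\<And>u v. set_integrable lborel (cbox u v) g"
    and cube: "\<And>u h. 0 < h \<Longrightarrow> 0 \<le> (LINT x:cbox u (u + h *\<^sub>R One)|lborel. g x)"
  shows "AE x in lborel. 0 \<le> g x"
proof -
  have HK: "g integrable_on cbox u v" "(LINT x:cbox u v|lborel. g x) = integral (cbox u v) g" for u v
    using set_borel_integral_eq_integral[OF int] by auto
  obtain N where N: "negligible N" "\<And>x e. \<lbrakk>x \<notin> N; 0 < e\<rbrakk> \<Longrightarrow> \<exists>d>0. \<forall>h. 0 < h \<and> h < d \<longrightarrow>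
      norm (integral (cbox x (x + h *\<^sub>R One)) g /\<^sub>R h ^ DIM('a) - g x) < e"
    using integrable_ccontinuous_explicit[OF HK(1)] by metis
  have pos: "0 \<le> g x" if xN: "x \<notin> N" for x
  proof (rule ccontr)
    assume "\<not> 0 \<le> g x"
    then obtain d where d: "d > 0" "\<forall>h. 0 < h \<and> h < d \<longrightarrow>
        norm (integral (cbox x (x + h *\<^sub>R One)) g /\<^sub>R h ^ DIM('a) - g x) < - g x"
      using N(2)[of x "- g x"] xN by auto
    have "0 \<le> integral (cbox x (x + (d/2) *\<^sub>R One)) g /\<^sub>R (d/2) ^ DIM('a)"
      using cube[of "d/2" x] d(1) HK(2) by auto
    then show False using d(2)[rule_format, of "d/2"] d(1) by auto
  qed
  have "N \<in> null_sets (completion lborel)"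
    using N(1) by (simp add: negligible_iff_null_sets)
  then have "AE x in completion lborel. x \<notin> N" by (rule AE_not_in)
  then have "AE x in lborel. x \<notin> N" by (simp add: AE_completion_iff)
  then show ?thesis by eventually_elim (rule pos)
qed

text \<open>
  A radial bump profile, as a function of the squared distance. The averages \<open>avg w s y\<close> below are
  squeezed, up to constants, between the means of \<open>w \<ge> 0\<close> over the discs about \<open>y\<close> of radius \<open>s / 2\<close>
  and \<open>s\<close> (\<open>avg_ge\<close>, \<open>avg_le\<close>); they are not normalised, and for \<open>w = 1\<close> they equal \<open>bump_integral\<close>.
\<close>
locale bump_average =
  fixes a :: "real \<Rightarrow> real" and c C :: real
  assumes c: "0 < c" "c \<le> 1" "1 \<le> C"
    and a_cont: "\<And>t. isCont a t"
    and a_bounds: "\<And>t. 0 \<le> a t" "\<And>t. a t \<le> C"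
    and a_out: "\<And>t. 1 \<le> t \<Longrightarrow> a t = 0" and a_in: "\<And>t. t \<le> 1/4 \<Longrightarrow> c \<le> a t"
begin

definition bump :: "real \<Rightarrow> real^2 \<Rightarrow> real^2 \<Rightarrow> real" where
  "bump s y x = a ((norm (x - y) / s)\<^sup>2) / s\<^sup>2"

definition bump_integral :: real where
  "bump_integral = (LINT z|lborel. a ((norm (z::real^2))\<^sup>2))"

definition avg :: "(real^2 \<Rightarrow> real) \<Rightarrow> real \<Rightarrow> real^2 \<Rightarrow> real" where
  "avg w s y = (LINT x|lborel. w x * bump s y x)"

lemma a_continuous: "continuous_on UNIV a"
  using a_cont by (simp add: continuous_at_imp_continuous_on)

lemma a_measurable [measurable]: "a \<in> borel_measurable borel"
  using a_continuous by (rule borel_measurable_continuous_onI)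

lemma bump_measurable [measurable]: "bump s y \<in> borel_measurable borel"
  unfolding bump_def by measurable

lemma bump_commute: "bump s y x = bump s x y"
  by (simp add: bump_def norm_minus_commute)

lemma bump_nonneg: "0 \<le> bump s y x"
  using a_bounds by (simp add: bump_def)

lemma bump_le: "bump s y x \<le> C / s\<^sup>2"
  using a_bounds by (simp add: bump_def divide_right_mono)

lemma bump_outside: "0 < s \<Longrightarrow> s \<le> dist x y \<Longrightarrow> bump s y x = 0"
  by (simp add: bump_def a_out dist_norm power_divide)

lemma bump_inside:
  assumes "0 < s" "dist x y \<le> s / 2"
  shows "c / s\<^sup>2 \<le> bump s y x"
proof -
  have "(norm (x - y) / s)\<^sup>2 \<le> (1/2)\<^sup>2"
    by (rule power_mono) (use assms in \<open>auto simp: dist_norm field_simps\<close>)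
  then have "c \<le> a ((norm (x - y) / s)\<^sup>2)"
    by (intro a_in) (simp add: power2_eq_square)
  then show ?thesis by (simp add: bump_def divide_right_mono)
qed

lemma bump_le_indicator: "0 < s \<Longrightarrow> bump s y x \<le> C / s\<^sup>2 * indicator (cball y s) x"
  using bump_le[of s y x] bump_outside[of s x y] by (auto simp: indicator_def dist_commute)

lemma nn_integral_bump:
  assumes s: "0 < s"
  shows "(\<integral>\<^sup>+x. ennreal (bump s y x) \<partial>lborel) = ennreal bump_integral"
proof -
  have bound: "a ((norm z)\<^sup>2) \<le> C * indicator (cball 0 1) z" for z :: "real^2"
    using a_bounds(2)[of "(norm z)\<^sup>2"] a_out[of "(norm z)\<^sup>2"] by (auto simp: indicator_def one_le_power)
  have "integrable lborel (\<lambda>z::real^2. C * indicator (cball 0 1) z)"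
    by (simp add: emeasure_cball)
  then have "integrable lborel (\<lambda>z::real^2. a ((norm z)\<^sup>2))"
    by (rule Bochner_Integration.integrable_bound) (use bound a_bounds c in auto)
  then have tot: "(\<integral>\<^sup>+z. ennreal (a ((norm (z::real^2))\<^sup>2)) \<partial>lborel) = ennreal bump_integral"
    unfolding bump_integral_def by (rule nn_integral_eq_integral) (use a_bounds in auto)
  have "(\<integral>\<^sup>+x. ennreal (bump s y x) \<partial>lborel)
      = (\<integral>\<^sup>+x. ennreal (bump s y x) \<partial>density (distr lborel borel (\<lambda>x. y + s *\<^sub>R x)) (\<lambda>_. ennreal (\<bar>s\<bar>^DIM(real^2))))"
    using s by (subst lborel_affine[of s y]) auto
  also have "\<dots> = (\<integral>\<^sup>+z. ennreal (\<bar>s\<bar>^DIM(real^2)) * ennreal (bump s y (y + s *\<^sub>R z)) \<partial>lborel)"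
    by (subst nn_integral_density, simp, simp, subst nn_integral_distr) auto
  also have "\<dots> = (\<integral>\<^sup>+z. ennreal (a ((norm (z::real^2))\<^sup>2)) \<partial>lborel)"
    using s a_bounds by (intro nn_integral_cong) (auto simp: bump_def ennreal_mult[symmetric])
  finally show ?thesis using tot by simp
qed

lemma bump_integral_nonneg: "0 \<le> bump_integral"
  unfolding bump_integral_def using a_bounds by (auto intro!: integral_nonneg)

lemma bump_integrable: "0 < s \<Longrightarrow> integrable lborel (bump s y)"
  by (rule integrableI_nonneg) (use nn_integral_bump bump_nonneg in auto)

lemma integral_bump: "0 < s \<Longrightarrow> (LINT x|lborel. bump s y x) = bump_integral"
proof -
  assume s: "0 < s"
  have "ennreal (LINT x|lborel. bump s y x) = ennreal bump_integral"
    using nn_integral_eq_integral[OF bump_integrable[OF s]] nn_integral_bump[OF s] bump_nonneg by simp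
  then show ?thesis
    using bump_integral_nonneg bump_nonneg by (simp add: integral_nonneg)
qed

context
  fixes w :: "real^2 \<Rightarrow> real"
  assumes w: "loc_density w"
begin

lemma w_measurable [measurable]: "w \<in> borel_measurable borel"
  using loc_densityD(1)[OF w] .

lemma avg_integrable:
  assumes s: "0 < s"
  shows "integrable lborel (\<lambda>x. w x * bump s y x)"
proof -
  have "integrable lborel (\<lambda>x. C / s\<^sup>2 * (indicator (cball y s) x *\<^sub>R w x))"
    using loc_densityD(3)[OF w, of "cball y s"] by (auto simp: set_integrable_def)
  then show ?thesis
  proof (rule Bochner_Integration.integrable_bound)
    show "AE x in lborel. norm (w x * bump s y x) \<le> norm (C / s\<^sup>2 * (indicator (cball y s) x *\<^sub>R w x))"
    proof (rule AE_I2)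
      fix x
      have "w x * bump s y x \<le> w x * (C / s\<^sup>2 * indicator (cball y s) x)"
        by (intro mult_left_mono bump_le_indicator[OF s] loc_densityD(2)[OF w])
      then show "norm (w x * bump s y x) \<le> norm (C / s\<^sup>2 * (indicator (cball y s) x *\<^sub>R w x))"
        using loc_densityD(2)[OF w] bump_nonneg c by (simp add: abs_mult mult_ac)
    qed
  qed simp
qed

lemma avg_nonneg: "0 \<le> avg w s y"
  unfolding avg_def by (rule Bochner_Integration.integral_nonneg) (use loc_densityD(2)[OF w] bump_nonneg in auto)

lemma avg_le:
  assumes s: "0 < s" and Q: "Q \<in> sets borel" "bounded Q" "ball y s \<subseteq> Q"
  shows "avg w s y \<le> C / s\<^sup>2 * (LINT x:Q|lborel. w x)"
proof -
  have "avg w s y \<le> (LINT x|lborel. C / s\<^sup>2 * (indicator Q x *\<^sub>R w x))"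
    unfolding avg_def
  proof (rule integral_mono[OF avg_integrable[OF s]])
    show "integrable lborel (\<lambda>x. C / s\<^sup>2 * (indicator Q x *\<^sub>R w x))"
      using loc_densityD(3)[OF w Q(1,2)] by (auto simp: set_integrable_def)
    show "w x * bump s y x \<le> C / s\<^sup>2 * (indicator Q x *\<^sub>R w x)" for x
    proof (cases "x \<in> Q")
      case True
      then show ?thesis
        using mult_left_mono[OF bump_le[of s y x] loc_densityD(2)[OF w, of x]] by (simp add: mult_ac)
    next
      case False
      then have "s \<le> dist x y" using Q(3) by (force simp: dist_commute not_less)
      then show ?thesis using bump_outside[OF s] False by simp
    qed
  qed
  then show ?thesis by (simp add: set_lebesgue_integral_def)
qed

lemma avg_ge:
  assumes s: "0 < s" and Q: "Q \<in> sets borel" "Q \<subseteq> cball y (s / 2)"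
  shows "c / s\<^sup>2 * (LINT x:Q|lborel. w x) \<le> avg w s y"
proof -
  have bQ: "bounded Q" using bounded_subset[OF bounded_cball Q(2)] .
  have "(LINT x|lborel. c / s\<^sup>2 * (indicator Q x *\<^sub>R w x)) \<le> avg w s y"
    unfolding avg_def
  proof (rule integral_mono[OF _ avg_integrable[OF s]])
    show "integrable lborel (\<lambda>x. c / s\<^sup>2 * (indicator Q x *\<^sub>R w x))"
      using loc_densityD(3)[OF w Q(1) bQ] by (auto simp: set_integrable_def)
    show "c / s\<^sup>2 * (indicator Q x *\<^sub>R w x) \<le> w x * bump s y x" for x
    proof (cases "x \<in> Q")
      case True
      then have "c / s\<^sup>2 \<le> bump s y x"
        using Q(2) by (intro bump_inside[OF s]) (auto simp: dist_commute)
      from mult_left_mono[OF this loc_densityD(2)[OF w, of x]] True show ?thesis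
        by (simp add: mult_ac)
    qed (use loc_densityD(2)[OF w] bump_nonneg in auto)
  qed
  then show ?thesis by (simp add: set_lebesgue_integral_def)
qed

lemma avg_measurable [measurable]: "avg w s \<in> borel_measurable borel"
proof -
  have "(\<lambda>(y, x). w x * bump s y x) \<in> borel_measurable (lborel \<Otimes>\<^sub>M lborel)"
    unfolding bump_def by measurable
  then have "(\<lambda>y. LINT x|lborel. w x * bump s y x) \<in> borel_measurable lborel"
    by (rule lborel.borel_measurable_lebesgue_integral)
  then show ?thesis by (simp add: avg_def[abs_def])
qed

lemma avg_loc_density:
  assumes s: "0 < s"
  shows "loc_density (avg w s)"
proof (rule loc_densityI)
  fix r
  have fin: "emeasure lborel (cball (0::real^2) r) < \<infinity>"
    by (rule emeasure_bounded_finite) simp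
  have bd: "avg w s y \<le> C / s\<^sup>2 * (LINT x:cball 0 (\<bar>r\<bar> + s)|lborel. w x)" if "y \<in> cball 0 r" for y
  proof (rule avg_le[OF s])
    show "ball y s \<subseteq> cball 0 (\<bar>r\<bar> + s)"
    proof
      fix x assume "x \<in> ball y s"
      then have "norm (x - y) < s" by (simp add: dist_norm norm_minus_commute)
      then show "x \<in> cball 0 (\<bar>r\<bar> + s)"
        using that norm_triangle_ineq[of y "x - y"] by simp
    qed
  qed auto
  have "integrable lborel (\<lambda>y::real^2. indicator (cball 0 r) y *\<^sub>R (C / s\<^sup>2 * (LINT x:cball 0 (\<bar>r\<bar> + s)|lborel. w x)))"
    by (rule integrable_scaleR_left) (use fin in simp)
  then show "set_integrable lborel (cball 0 r) (avg w s)"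
    unfolding set_integrable_def
    by (rule Bochner_Integration.integrable_bound)
      (use bd avg_nonneg in \<open>auto simp: indicator_def intro!: AE_I2 order_trans[OF bd] order_trans[OF _ abs_ge_self] divide_right_mono\<close>)
qed (auto intro: avg_nonneg)

text \<open>
  Exchange the integrals: averaging spreads the mass of \<open>w\<close> by at most \<open>s\<close> in every direction.
\<close>
lemma avg_cube_le:
  assumes s: "0 < s"
  shows "(LINT y:cbox u v|lborel. avg w s y) \<le>
    bump_integral * (LINT x:cbox (u - s *\<^sub>R One) (v + s *\<^sub>R One)|lborel. w x)"
proof -
  let ?Q = "cbox u v" and ?Q' = "cbox (u - s *\<^sub>R One) (v + s *\<^sub>R One)"
  have near: "x \<in> ?Q'" if "y \<in> ?Q" "dist x y < s" for x y :: "real^2"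
    unfolding mem_box
  proof
    fix i :: "real^2" assume i: "i \<in> Basis"
    have "\<bar>(x - y) \<bullet> i\<bar> < s"
      using Basis_le_norm[OF i, of "x - y"] that(2) by (simp add: dist_norm)
    moreover have "u \<bullet> i \<le> y \<bullet> i" "y \<bullet> i \<le> v \<bullet> i" using that(1) i by (auto simp: mem_box)
    ultimately show "(u - s *\<^sub>R One) \<bullet> i \<le> x \<bullet> i \<and> x \<bullet> i \<le> (v + s *\<^sub>R One) \<bullet> i"
      using i by (auto simp: inner_diff_left inner_add_left abs_less_iff)
  qed
  have int: "set_integrable lborel ?Q (avg w s)"
    using loc_densityD(3)[OF avg_loc_density[OF s]] by simp
  have int': "set_integrable lborel ?Q' w"
    using loc_densityD(3)[OF w] by simp
  have "ennreal (LINT y:?Q|lborel. avg w s y) = (\<integral>\<^sup>+y. ennreal (indicator ?Q y *\<^sub>R avg w s y) \<partial>lborel)"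
    unfolding set_lebesgue_integral_def
    by (rule nn_integral_eq_integral[symmetric])
      (use int avg_nonneg in \<open>auto simp: set_integrable_def\<close>)
  also have "\<dots> = (\<integral>\<^sup>+y. (\<integral>\<^sup>+x. ennreal (w x) * (indicator ?Q y * ennreal (bump s y x)) \<partial>lborel) \<partial>lborel)"
  proof (rule nn_integral_cong)
    fix y
    have "ennreal (avg w s y) = (\<integral>\<^sup>+x. ennreal (w x * bump s y x) \<partial>lborel)"
      unfolding avg_def
      by (rule nn_integral_eq_integral[symmetric]) (use avg_integrable[OF s] loc_densityD(2)[OF w] bump_nonneg in auto)
    then show "ennreal (indicator ?Q y *\<^sub>R avg w s y)
        = (\<integral>\<^sup>+x. ennreal (w x) * (indicator ?Q y * ennreal (bump s y x)) \<partial>lborel)"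
      using loc_densityD(2)[OF w] bump_nonneg by (auto simp: indicator_def ennreal_mult)
  qed
  also have "\<dots> = (\<integral>\<^sup>+x. (\<integral>\<^sup>+y. ennreal (w x) * (indicator ?Q y * ennreal (bump s y x)) \<partial>lborel) \<partial>lborel)"
    by (rule lborel_pair.Fubini') (unfold bump_def, measurable)
  also have "\<dots> \<le> (\<integral>\<^sup>+x. ennreal bump_integral * ennreal (indicator ?Q' x *\<^sub>R w x) \<partial>lborel)"
  proof (rule nn_integral_mono)
    fix x
    have "(\<integral>\<^sup>+y. ennreal (w x) * (indicator ?Q y * ennreal (bump s y x)) \<partial>lborel)
        \<le> (\<integral>\<^sup>+y. ennreal (indicator ?Q' x *\<^sub>R w x) * ennreal (bump s x y) \<partial>lborel)"
    proof (rule nn_integral_mono)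
      fix y
      show "ennreal (w x) * (indicator ?Q y * ennreal (bump s y x)) \<le> ennreal (indicator ?Q' x *\<^sub>R w x) * ennreal (bump s x y)"
      proof (cases "y \<in> ?Q \<and> dist x y < s")
        case True
        then show ?thesis using near[of y x] by (simp add: bump_commute[of s x y])
      next
        case False
        then have "y \<notin> ?Q \<or> bump s y x = 0" using bump_outside[OF s] not_le by blast
        then show ?thesis by auto
      qed
    qed
    also have "\<dots> = ennreal (indicator ?Q' x *\<^sub>R w x) * ennreal bump_integral"
      using nn_integral_bump[OF s] by (subst nn_integral_cmult) auto
    finally show "(\<integral>\<^sup>+y. ennreal (w x) * (indicator ?Q y * ennreal (bump s y x)) \<partial>lborel)
        \<le> ennreal bump_integral * ennreal (indicator ?Q' x *\<^sub>R w x)" by (simp add: mult.commute)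
  qed
  also have "\<dots> = ennreal bump_integral * ennreal (LINT x:?Q'|lborel. w x)"
    unfolding set_lebesgue_integral_def
    by (subst nn_integral_cmult, simp, subst nn_integral_eq_integral)
      (use int' loc_densityD(2)[OF w] in \<open>auto simp: set_integrable_def\<close>)
  finally show ?thesis
    using bump_integral_nonneg loc_density_mass_nonneg[OF w] by (simp add: ennreal_mult[symmetric])
qed

lemma avg_cube_limit:
  assumes s: "0 < s" and E: "\<And>n y. avg w s y \<le> avg w (s / 2 ^ n) y + E"
  shows "(LINT y:cbox u v|lborel. avg w s y) \<le>
    bump_integral * (LINT x:cbox u v|lborel. w x) + E * measure lborel (cbox u v)"
proof -
  define Q where "Q n = cbox (u - (s / 2 ^ n) *\<^sub>R One) (v + (s / 2 ^ n) *\<^sub>R One)" for n :: nat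
  have bound: "(LINT y:cbox u v|lborel. avg w s y)
      \<le> bump_integral * (LINT x:Q n|lborel. w x) + E * measure lborel (cbox u v)" for n
  proof -
    have sn: "0 < s / 2 ^ n" using s by simp
    have int: "set_integrable lborel (cbox u v) (avg w t)" if "0 < t" for t
      using loc_densityD(3)[OF avg_loc_density[OF that]] by simp
    have intE: "set_integrable lborel (cbox u v) (\<lambda>_. E)"
      unfolding set_integrable_def by (rule integrable_scaleR_left) (simp add: emeasure_lborel_cbox_eq)
    have "(LINT y:cbox u v|lborel. avg w s y) \<le> (LINT y:cbox u v|lborel. avg w (s / 2 ^ n) y + E)"
      by (rule set_integral_mono) (use int s sn E intE in \<open>auto intro!: set_integral_add\<close>)
    also have "\<dots> = (LINT y:cbox u v|lborel. avg w (s / 2 ^ n) y) + E * measure lborel (cbox u v)"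
      by (subst set_integral_add(2)[OF int[OF sn] intE]) (simp add: set_lebesgue_integral_def)
    also have "\<dots> \<le> bump_integral * (LINT x:Q n|lborel. w x) + E * measure lborel (cbox u v)"
      unfolding Q_def using avg_cube_le[OF sn] by simp
    finally show ?thesis .
  qed
  have lim: "(\<lambda>n. LINT x:Q n|lborel. w x) \<longlonglongrightarrow> (LINT x:(\<Inter>n. Q n)|lborel. w x)"
  proof (rule set_integral_cont_down)
    show "decseq Q"
    proof (rule decseq_SucI)
      fix n
      have "s / 2 ^ Suc n \<le> s / 2 ^ n" using s by (simp add: field_simps)
      then show "Q (Suc n) \<subseteq> Q n"
        unfolding Q_def by (intro subset_box_imp) (auto simp: inner_diff_left inner_add_left)
    qed
    show "set_integrable lborel (Q 0) w" unfolding Q_def using loc_densityD(3)[OF w] by simp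
  qed (simp add: Q_def)
  have Inter: "(\<Inter>n. Q n) = cbox u v"
  proof -
    have "(\<lambda>n. s * (1/2) ^ n) \<longlonglongrightarrow> s * 0"
      by (intro tendsto_intros LIMSEQ_power_zero) simp
    then have lim: "(\<lambda>n. s / 2 ^ n) \<longlonglongrightarrow> 0" by (simp add: power_divide)
    have "x \<in> cbox u v" if "\<And>n. x \<in> Q n" for x
      unfolding mem_box
    proof
      fix i :: "real^2" assume i: "i \<in> Basis"
      have *: "u \<bullet> i - s / 2 ^ n \<le> x \<bullet> i" "x \<bullet> i \<le> v \<bullet> i + s / 2 ^ n" for n
        using that[of n] i by (auto simp: Q_def mem_box inner_diff_left inner_add_left)
      have "u \<bullet> i - 0 \<le> x \<bullet> i"
        by (rule LIMSEQ_le_const2[OF tendsto_diff[OF tendsto_const lim]]) (use * in blast)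
      moreover have "x \<bullet> i \<le> v \<bullet> i + 0"
        by (rule LIMSEQ_le_const[OF tendsto_add[OF tendsto_const lim]]) (use * in blast)
      ultimately show "u \<bullet> i \<le> x \<bullet> i \<and> x \<bullet> i \<le> v \<bullet> i" by simp
    qed
    moreover have "cbox u v \<subseteq> Q n" for n
      unfolding Q_def using s by (intro subset_box_imp) (auto simp: inner_diff_left inner_add_left)
    ultimately show ?thesis by blast
  qed
  have "(\<lambda>n. bump_integral * (LINT x:Q n|lborel. w x) + E * measure lborel (cbox u v))
      \<longlonglongrightarrow> bump_integral * (LINT x:cbox u v|lborel. w x) + E * measure lborel (cbox u v)"
    by (intro tendsto_intros lim[unfolded Inter])
  then show ?thesis
    by (rule LIMSEQ_le_const) (use bound in blast)
qed

text \<open>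
  The hypothesis compares the average at scale \<open>s\<close> with averages at arbitrarily small scales, and
  those tend to \<open>bump_integral * w y\<close> for almost every \<open>y\<close>. Since \<open>w\<close> is only locally integrable, the
  limit is taken after integration over a cube (\<open>avg_cube_limit\<close>), and the pointwise inequality is
  recovered by Lebesgue differentiation.
\<close>
lemma AE_avg_le:
  assumes s: "0 < s" and E: "\<And>n y. avg w s y \<le> avg w (s / 2 ^ n) y + E"
  shows "AE y in lborel. avg w s y \<le> bump_integral * w y + E"
proof -
  have int: "set_integrable lborel (cbox u v) (avg w s)" "set_integrable lborel (cbox u v) w" for u v
    using loc_densityD(3)[OF avg_loc_density[OF s]] loc_densityD(3)[OF w] by auto
  have intE: "set_integrable lborel (cbox u v) (\<lambda>_. E)" for u v :: "real^2"
    unfolding set_integrable_def by (rule integrable_scaleR_left) (simp add: emeasure_lborel_cbox_eq)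
  have "AE y in lborel. 0 \<le> bump_integral * w y + E - avg w s y"
  proof (rule AE_nonneg_if_cube_integrals_nonneg)
    show "set_integrable lborel (cbox u v) (\<lambda>y. bump_integral * w y + E - avg w s y)" for u v
      by (intro set_integral_diff(1) set_integral_add(1) set_integrable_mult_right int intE)
    show "0 \<le> (LINT y:cbox u (u + h *\<^sub>R One)|lborel. bump_integral * w y + E - avg w s y)" for u h
    proof -
      let ?Q = "cbox u (u + h *\<^sub>R One)"
      have "(LINT y:?Q|lborel. bump_integral * w y + E - avg w s y)
          = bump_integral * (LINT y:?Q|lborel. w y) + (LINT y:?Q|lborel. E) - (LINT y:?Q|lborel. avg w s y)"
        using int intE by (simp add: set_integral_diff set_integral_add)
      also have "(LINT y:?Q|lborel. E) = E * measure lborel ?Q"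
        by (simp add: set_lebesgue_integral_def)
      finally show ?thesis using avg_cube_limit[OF s E, of u "u + h *\<^sub>R One"] by simp
    qed
  qed
  then show ?thesis by eventually_elim simp
qed

end

end

section \<open>Growth of the mass on cubes\<close>

abbreviation cube :: "real^2 \<Rightarrow> real \<Rightarrow> (real^2) set" where
  "cube y r \<equiv> cbox y (y + r *\<^sub>R One)"

abbreviation grid_point :: "nat \<Rightarrow> nat \<Rightarrow> real^2" where
  "grid_point i j \<equiv> vector [real i, real j]"

lemma One_component [simp]: "(One :: real^'n) $ i = 1"
proof -
  have "(One :: real^'n) \<bullet> axis i 1 = 1" 
    using inner_sum_left_Basis[of "axis i 1 :: real^'n" "\<lambda>_. 1"] by (simp add: axis_in_Basis_iff)
  then show ?thesis by (simp add: inner_axis)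
qed

lemma mem_cube: "x \<in> cube y r \<longleftrightarrow>
    y$1 \<le> x$1 \<and> x$1 \<le> y$1 + r \<and> y$2 \<le> x$2 \<and> x$2 \<le> y$2 + r"
  by (auto simp del: sum_component simp: mem_box_cart forall_2)

lemma measure_cube: "0 \<le> r \<Longrightarrow> measure lborel (cube y r) = r\<^sup>2"
  by (subst measure_lborel_cbox) (auto simp: inner_add_left)

lemma cube_subset_cball:
  assumes "p \<in> cube y r"
  shows "cube y r \<subseteq> cball p (2 * r)"
proof
  fix x assume "x \<in> cube y r"
  then have "\<bar>(p - x)$1\<bar> \<le> r" "\<bar>(p - x)$2\<bar> \<le> r" using assms by (auto simp: mem_cube)
  then show "x \<in> cball p (2 * r)"
    using norm_le_l1_cart[of "p - x"] by (simp add: dist_norm sum_2)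
qed

lemma ball_subset_cube: "ball (y + r *\<^sub>R One) r \<subseteq> cube y (2 * r)"
proof
  fix x assume x: "x \<in> ball (y + r *\<^sub>R One) r"
  have "\<bar>(y + r *\<^sub>R One - x)$i\<bar> < r" for i
    using component_le_norm_cart[of "y + r *\<^sub>R One - x" i] x by (simp add: dist_norm)
  from this[of 1] this[of 2] show "x \<in> cube y (2 * r)"
    unfolding mem_cube by (auto simp del: sum_component simp: abs_less_iff)
qed

lemma grid_coordinate:
  fixes t r :: real
  assumes "0 \<le> t" "t \<le> real k * r" "0 < r" "0 < k"
  obtains i where "i < k" "real i * r \<le> t" "t \<le> real i * r + r"
proof (cases "t = real k * r")
  case True
  then show thesis using assms by (intro that[of "k - 1"]) (auto simp: of_nat_diff algebra_simps)
next
  case False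
  define i where "i = nat \<lfloor>t / r\<rfloor>"
  have i: "real i \<le> t / r" "t / r < real i + 1" using assms by (auto simp: i_def)
  then have "real i * r \<le> t" "t \<le> real i * r + r" using assms(3) by (auto simp: field_simps)
  moreover have "i < k"
  proof -
    have "t / r < real k" using False assms by (simp add: field_simps)
    then show ?thesis using i(1) by linarith
  qed
  ultimately show thesis using that by blast
qed

text \<open>
  A cover suffices in the sequel, as masses are only ever bounded by sums over the grid; closed cubes
  overlap in their faces.
\<close>
lemma cube_subset_grid:
  assumes "0 < r" "0 < k"
  shows "cube y (real k * r) \<subseteq> (\<Union>(i, j)\<in>{..<k} \<times> {..<k}. cube (y + r *\<^sub>R grid_point i j) r)"
proof
  fix x assume x: "x \<in> cube y (real k * r)"
  obtain i where i: "i < k" "real i * r \<le> x$1 - y$1" "x$1 - y$1 \<le> real i * r + r"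
    by (rule grid_coordinate[of "x$1 - y$1" k r]) (use x assms in \<open>auto simp: mem_cube\<close>)
  obtain j where j: "j < k" "real j * r \<le> x$2 - y$2" "x$2 - y$2 \<le> real j * r + r"
    by (rule grid_coordinate[of "x$2 - y$2" k r]) (use x assms in \<open>auto simp: mem_cube\<close>)
  have "x \<in> cube (y + r *\<^sub>R grid_point i j) r"
    unfolding mem_cube using i j by (simp add: algebra_simps)
  then show "x \<in> (\<Union>(i, j)\<in>{..<k} \<times> {..<k}. cube (y + r *\<^sub>R grid_point i j) r)"
    using i(1) j(1) by force
qed

text \<open>
  The setting of the growth estimate. The identity \<open>avg_halving\<close> is the equation \<open>\<Delta>w = f\<close> tested
  against the function of \<open>telescoping_kernel\<close>.
\<close>
locale exponential_density = bump_average +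
  fixes N :: "real \<Rightarrow> real" and w f :: "real^2 \<Rightarrow> real" and B :: real
  assumes N_cont: "\<And>t. isCont N t"
    and N_bounds: "\<And>t. 0 \<le> t \<Longrightarrow> 0 \<le> N t" "\<And>t. 0 \<le> t \<Longrightarrow> N t \<le> C"
    and N_out: "\<And>t. 1 \<le> t \<Longrightarrow> N t = 0"
    and N_in: "\<And>t. 0 \<le> t \<Longrightarrow> t \<le> 1/64 \<Longrightarrow> c \<le> N t"
    and w_density: "loc_density w"
    and f_measurable [measurable]: "f \<in> borel_measurable borel"
    and f_nonneg: "\<And>x. 0 \<le> f x"
    and f_le: "\<And>x. f x \<le> B * exp (- 2 * w x)"
    and B: "0 < B"
    and avg_halving: "\<And>y s. 0 < s \<Longrightarrow>
      avg w s y - avg w (s / 2) y = (LINT x|lborel. f x * N ((norm (x - y) / s)\<^sup>2))"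
begin

abbreviation mass :: "(real^2) set \<Rightarrow> real" where
  "mass S \<equiv> (LINT x:S|lborel. f x)"

lemma f_le_B: "f x \<le> B"
proof -
  have "exp (- 2 * w x) \<le> 1" using loc_densityD(2)[OF w_density] by simp
  then have "B * exp (- 2 * w x) \<le> B" using B by simp
  then show ?thesis using f_le[of x] by linarith
qed

lemma N_measurable [measurable]: "N \<in> borel_measurable borel"
  by (rule borel_measurable_continuous_onI) (simp add: N_cont continuous_at_imp_continuous_on)

lemma f_integrable_on_bounded:
  assumes "S \<in> sets borel" "bounded S"
  shows "set_integrable lborel S f"
proof -
  have "integrable lborel (\<lambda>x. indicator S x *\<^sub>R B)"
    by (rule integrable_scaleR_left) (use assms emeasure_bounded_finite[of S] in simp)
  then show ?thesis
    unfolding set_integrable_def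
    by (rule Bochner_Integration.integrable_bound)
      (use assms f_nonneg f_le_B B in \<open>auto simp: indicator_def abs_of_nonneg intro!: AE_I2\<close>)
qed

lemma f_density: "loc_density f"
  unfolding loc_density_def by (intro conjI allI ballI impI f_measurable f_nonneg f_integrable_on_bounded)

lemma mass_cube_le:
  assumes "0 \<le> r"
  shows "mass (cube y r) \<le> B * r\<^sup>2"
proof -
  have "mass (cube y r) \<le> (LINT x:cube y r|lborel. B)"
  proof (rule set_integral_mono)
    show "set_integrable lborel (cube y r) (\<lambda>_. B)"
      unfolding set_integrable_def by (rule integrable_scaleR_left) (simp add: emeasure_lborel_cbox_eq)
  qed (use f_integrable_on_bounded f_le_B in auto)
  also have "\<dots> = B * measure lborel (cube y r)"
    by (simp add: set_lebesgue_integral_def)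
  finally show ?thesis using measure_cube[OF assms] by simp
qed

lemma N_term_integrable:
  assumes s: "0 < s"
  shows "integrable lborel (\<lambda>x. f x * N ((norm (x - y) / s)\<^sup>2))"
    and "f x * N ((norm (x - y) / s)\<^sup>2) \<le> C * (indicator (ball y s) x *\<^sub>R f x)"
proof -
  have bound: "f x * N ((norm (x - y) / s)\<^sup>2) \<le> C * (indicator (ball y s) x *\<^sub>R f x)" for x
  proof (cases "x \<in> ball y s")
    case True
    then show ?thesis
      using mult_left_mono[OF N_bounds(2)[of "(norm (x - y) / s)\<^sup>2"] f_nonneg[of x]] by (simp add: mult.commute)
  next
    case False
    then have "1 \<le> norm (x - y) / s" using s by (simp add: dist_norm norm_minus_commute)
    then have "N ((norm (x - y) / s)\<^sup>2) = 0" by (intro N_out) (simp add: one_le_power)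
    then show ?thesis using False by simp
  qed
  then show "f x * N ((norm (x - y) / s)\<^sup>2) \<le> C * (indicator (ball y s) x *\<^sub>R f x)" .
  have "integrable lborel (\<lambda>x. C * (indicator (ball y s) x *\<^sub>R f x))"
    using loc_densityD(3)[OF f_density, of "ball y s"] by (auto simp: set_integrable_def)
  then show "integrable lborel (\<lambda>x. f x * N ((norm (x - y) / s)\<^sup>2))"
  proof (rule Bochner_Integration.integrable_bound)
    show "AE x in lborel. norm (f x * N ((norm (x - y) / s)\<^sup>2)) \<le> norm (C * (indicator (ball y s) x *\<^sub>R f x))"
      using bound f_nonneg N_bounds(1) by (intro AE_I2) (simp add: order_trans[OF _ abs_ge_self])
  qed simp
qed

lemma avg_ge_mass:
  assumes s: "0 < s" and S: "S \<in> sets borel" "S \<subseteq> cball y (s / 8)"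
  shows "c * mass S \<le> avg w s y"
proof -
  have bS: "bounded S" using bounded_subset[OF bounded_cball S(2)] .
  have "c * mass S = (LINT x|lborel. c * (indicator S x *\<^sub>R f x))"
    by (simp add: set_lebesgue_integral_def)
  also have "\<dots> \<le> (LINT x|lborel. f x * N ((norm (x - y) / s)\<^sup>2))"
  proof (rule integral_mono[OF _ N_term_integrable(1)[OF s]])
    show "integrable lborel (\<lambda>x. c * (indicator S x *\<^sub>R f x))"
      using loc_densityD(3)[OF f_density S(1) bS] by (auto simp: set_integrable_def)
    show "c * (indicator S x *\<^sub>R f x) \<le> f x * N ((norm (x - y) / s)\<^sup>2)" for x
    proof (cases "x \<in> S")
      case True
      have "norm (x - y) / s \<le> 1/8"
        using S(2) True s by (auto simp: dist_norm norm_minus_commute field_simps)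
      then have "(norm (x - y) / s)\<^sup>2 \<le> (1/8)\<^sup>2" by (rule power_mono) (use s in simp)
      then have "c \<le> N ((norm (x - y) / s)\<^sup>2)" by (intro N_in) (auto simp: power2_eq_square)
      from mult_left_mono[OF this f_nonneg[of x]] show ?thesis using True by (simp add: mult.commute)
    qed (use f_nonneg N_bounds(1) in simp)
  qed
  also have "\<dots> = avg w s y - avg w (s / 2) y" using avg_halving[OF s] by simp
  also have "\<dots> \<le> avg w s y" using avg_nonneg[OF w_density] by simp
  finally show ?thesis .
qed

lemma avg_le_avg_half:
  assumes s: "0 < s"
  shows "avg w s y \<le> avg w (s / 2) y + C * mass (ball y s)"
proof -
  have "(LINT x|lborel. f x * N ((norm (x - y) / s)\<^sup>2)) \<le> (LINT x|lborel. C * (indicator (ball y s) x *\<^sub>R f x))"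
    by (rule integral_mono[OF N_term_integrable(1)[OF s] _ N_term_integrable(2)[OF s]])
      (use loc_densityD(3)[OF f_density, of "ball y s"] in \<open>auto simp: set_integrable_def\<close>)
  then show ?thesis
    using avg_halving[OF s, of y] by (simp add: set_lebesgue_integral_def)
qed

lemma avg_le_avg_small:
  assumes s: "0 < s"
  shows "avg w s y \<le> avg w (s / 2 ^ n) y + C * (\<Sum>j<n. mass (ball y (s / 2 ^ j)))"
proof (induction n)
  case (Suc n)
  have "avg w (s / 2 ^ n) y \<le> avg w (s / 2 ^ Suc n) y + C * mass (ball y (s / 2 ^ n))"
    using avg_le_avg_half[of "s / 2 ^ n" y] s by (simp add: field_simps)
  then show ?case using Suc by (simp add: algebra_simps)
qed simp

text \<open>
  The induction step: the bound \<open>A q ^ m\<close> is available at all scales below \<open>n\<close>.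
\<close>
context
  fixes q A :: real and n :: nat
  assumes q: "2 \<le> q" "q \<le> 4" and A: "1 \<le> A" "4 * B \<le> A"
    and smaller: "\<And>m y. m < n \<Longrightarrow> mass (cube y (2 ^ m)) \<le> A * q ^ m"
begin

text \<open>
  Above scale 1 the hypothesis on smaller cubes gives decay by \<open>1 / q \<le> 1 / 2\<close> at each halving; below
  scale 1 it is the boundedness of \<open>f\<close> that gives decay by \<open>1 / 4\<close>.
\<close>
lemma ball_mass_geometric:
  assumes p: "p + 4 \<le> n"
  shows "mass (ball y (2 ^ (p + 2) / 2 ^ j)) \<le> A * q ^ (p + 3) * (1/2) ^ j"
proof -
  let ?r = "2 ^ (p + 2) / 2 ^ j :: real"
  have "mass (ball y ?r) \<le> mass (cube (y - ?r *\<^sub>R One) (2 * ?r))"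
    using ball_subset_cube[of "y - ?r *\<^sub>R One" ?r] by (intro loc_density_mass_mono[OF f_density]) auto
  also have "\<dots> \<le> A * q ^ (p + 3) * (1/2) ^ j"
  proof (cases "j \<le> p + 2")
    case True
    then have "2 * ?r = 2 ^ (p + 3 - j)"
      by (simp add: power_diff Suc_diff_le field_simps power_add)
    then have "mass (cube (y - ?r *\<^sub>R One) (2 * ?r)) \<le> A * q ^ (p + 3 - j)"
      using smaller[of "p + 3 - j"] p by simp
    also have "q ^ (p + 3 - j) = q ^ (p + 3) / q ^ j"
      using True q by (simp add: power_diff)
    also have "\<dots> \<le> q ^ (p + 3) / 2 ^ j"
      using q by (intro divide_left_mono power_mono) auto
    finally show ?thesis using A(1) by (simp add: field_simps power_divide)
  next
    case False
    have "mass (cube (y - ?r *\<^sub>R One) (2 * ?r)) \<le> B * (2 * ?r)\<^sup>2"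
      by (rule mass_cube_le) simp
    also have "(2 * ?r)\<^sup>2 \<le> q ^ (p + 3) * (1/2) ^ j"
    proof -
      have "(2 ^ (p + 3))\<^sup>2 = (2::real) ^ (p + 3) * 2 ^ (p + 3)" by (simp add: power2_eq_square)
      also have "\<dots> \<le> q ^ (p + 3) * 2 ^ j"
        using False q by (intro mult_mono power_mono power_increasing) auto
      finally have "(2 ^ (p + 3))\<^sup>2 / (2 ^ j)\<^sup>2 \<le> q ^ (p + 3) * 2 ^ j / (2 ^ j)\<^sup>2"
        by (rule divide_right_mono) simp
      then show ?thesis by (simp add: power_divide power2_eq_square power_add field_simps)
    qed
    also have "B * (q ^ (p + 3) * (1/2) ^ j) \<le> A * (q ^ (p + 3) * (1/2) ^ j)"
      using A B q by (intro mult_right_mono) auto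
    finally show ?thesis using B by (simp add: mult.assoc)
  qed
  finally show ?thesis .
qed

lemma ball_mass_sum:
  assumes p: "p + 4 \<le> n"
  shows "(\<Sum>j<k. mass (ball y (2 ^ (p + 2) / 2 ^ j))) \<le> 128 * A * q ^ p"
proof -
  have "(\<Sum>j<k. mass (ball y (2 ^ (p + 2) / 2 ^ j))) \<le> (\<Sum>j<k. A * q ^ (p + 3) * (1/2) ^ j)"
    by (intro sum_mono ball_mass_geometric p)
  also have "\<dots> = A * q ^ (p + 3) * (\<Sum>j<k. (1/2) ^ j)" by (simp add: sum_distrib_left)
  also have "\<dots> \<le> A * q ^ (p + 3) * 2"
    using A q by (intro mult_left_mono) (auto simp: geometric_sum)
  also have "\<dots> = 2 * A * q ^ p * q ^ 3" by (simp add: power_add)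
  also have "\<dots> \<le> 2 * A * q ^ p * 4 ^ 3"
    using A q by (intro mult_left_mono power_mono) auto
  finally show ?thesis by simp
qed

text \<open>
  Since \<open>f \<le> B exp (- 2 w)\<close>, a point where \<open>f\<close> is at least half its mean over the cube has
  \<open>exp (2 w) \<le> (4 / q) ^ p \<le> 2 ^ p\<close>. Such points fill a set of positive measure, so any property
  that holds almost everywhere can be required as well.
\<close>
lemma exists_low_point:
  assumes P: "A * q ^ p / 2 \<le> mass (cube y (2 ^ p))" and Z: "AE x in lborel. Z x"
  obtains x where "x \<in> cube y (2 ^ p)" "Z x" "w x \<le> q ^ p"
proof -
  have Apos: "0 < A * q ^ p" using A q by simp
  have "\<exists>x\<in>cube y (2 ^ p). Z x \<and> A * (q / 4) ^ p / 4 < f x"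
  proof (rule ccontr)
    assume no: "\<not> ?thesis"
    have "mass (cube y (2 ^ p)) \<le> (LINT x:cube y (2 ^ p)|lborel. A * (q / 4) ^ p / 4)"
      unfolding set_lebesgue_integral_def
    proof (rule integral_mono_AE)
      show "integrable lborel (\<lambda>x. indicator (cube y (2 ^ p)) x *\<^sub>R f x)"
        using f_integrable_on_bounded[of "cube y (2 ^ p)"] by (simp add: set_integrable_def)
      show "integrable lborel (\<lambda>x. indicator (cube y (2 ^ p)) x *\<^sub>R (A * (q / 4) ^ p / 4))"
        by (rule integrable_scaleR_left) (simp add: emeasure_lborel_cbox_eq)
      show "AE x in lborel. indicator (cube y (2 ^ p)) x *\<^sub>R f x
          \<le> indicator (cube y (2 ^ p)) x *\<^sub>R (A * (q / 4) ^ p / 4)"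
        using Z by eventually_elim (use no in \<open>force simp: indicator_def\<close>)
    qed
    also have "\<dots> = A * (q / 4) ^ p / 4 * (2 ^ p)\<^sup>2"
      using measure_cube[of "2 ^ p" y] by (simp add: set_lebesgue_integral_def)
    also have "(2 ^ p)\<^sup>2 = (4::real) ^ p"
      by (simp add: power2_eq_square flip: power_mult_distrib)
    finally show False using P Apos by (simp add: power_divide)
  qed
  then obtain x where x: "x \<in> cube y (2 ^ p)" "Z x" "A * (q / 4) ^ p / 4 < f x" by blast
  have "B * (1/2) ^ p \<le> A / 4 * (q / 4) ^ p"
    using A B q by (intro mult_mono power_mono) auto
  also have "\<dots> < B * exp (- 2 * w x)" using x(3) f_le[of x] by simp
  finally have "(1/2) ^ p < exp (- 2 * w x)" using B by simp
  then have "exp (2 * w x) < 2 ^ p"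
    by (simp add: exp_minus power_divide field_simps)
  moreover have "w x \<le> exp (2 * w x)"
    using exp_ge_add_one_self[of "2 * w x"] loc_densityD(2)[OF w_density, of x] by linarith
  moreover have "(2::real) ^ p \<le> q ^ p" using q by (intro power_mono) auto
  ultimately have "w x \<le> q ^ p" by linarith
  then show thesis using x that by blast
qed

text \<open>
  The cube lies in the disc of radius \<open>2 * 2 ^ p\<close> about each of its points, half the scale used here. So
  the average of \<open>w\<close> about one low point controls its integral over the entire cube.
\<close>
lemma w_mass_le:
  assumes p: "p + 4 \<le> n" and P: "A * q ^ p / 2 \<le> mass (cube y (2 ^ p))"
  shows "(LINT x:cube y (2 ^ p)|lborel. w x) \<le> 16 / c * 4 ^ p * ((bump_integral + 128 * C) * A * q ^ p)"
proof -
  let ?s = "2 ^ (p + 2) :: real"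
  have "AE x in lborel. avg w ?s x \<le> bump_integral * w x + C * (128 * A * q ^ p)"
  proof (rule AE_avg_le[OF w_density])
    fix k x
    have "avg w ?s x \<le> avg w (?s / 2 ^ k) x + C * (\<Sum>j<k. mass (ball x (?s / 2 ^ j)))"
      by (rule avg_le_avg_small) simp
    also have "\<dots> \<le> avg w (?s / 2 ^ k) x + C * (128 * A * q ^ p)"
      using ball_mass_sum[OF p] c by (intro add_left_mono mult_left_mono) auto
    finally show "avg w ?s x \<le> avg w (?s / 2 ^ k) x + C * (128 * A * q ^ p)" .
  qed simp
  then obtain x where x: "x \<in> cube y (2 ^ p)" "avg w ?s x \<le> bump_integral * w x + C * (128 * A * q ^ p)" "w x \<le> q ^ p"
    using exists_low_point[OF P] by blast
  have "c / ?s\<^sup>2 * (LINT x:cube y (2 ^ p)|lborel. w x) \<le> avg w ?s x"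
    using cube_subset_cball[OF x(1)] by (intro avg_ge[OF w_density]) auto
  also have "\<dots> \<le> bump_integral * (A * q ^ p) + C * (128 * A * q ^ p)"
  proof -
    have "bump_integral * w x \<le> bump_integral * (A * q ^ p)"
      using x(3) mult_right_mono[OF A(1), of "q ^ p"] q bump_integral_nonneg by (intro mult_left_mono) (auto intro: order_trans)
    then show ?thesis using x(2) by simp
  qed
  also have "\<dots> = (bump_integral + 128 * C) * A * q ^ p" by (simp add: algebra_simps)
  finally have "(LINT x:cube y (2 ^ p)|lborel. w x) \<le> ?s\<^sup>2 / c * ((bump_integral + 128 * C) * A * q ^ p)"
    using c(1) by (simp add: field_simps)
  also have "?s\<^sup>2 = 16 * 4 ^ p"
    by (simp add: power_add power2_eq_square flip: power_mult_distrib)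
  finally show ?thesis by simp
qed

context
  fixes y :: "real^2"
  assumes large: "A * q ^ n < mass (cube y (2 ^ n))"
begin

text \<open>
  The other \<open>4 ^ m - 1\<close> subcubes carry at most \<open>(4 ^ m - 1) A q ^ (n - m)\<close>, which falls short of
  \<open>A q ^ n = q ^ m A q ^ (n - m)\<close> by at least half a unit \<open>A q ^ (n - m)\<close>.
\<close>
lemma subcube_mass_large:
  assumes m: "0 < m" "m \<le> n" and qm: "4 ^ m - 1/2 \<le> q ^ m" and ij: "i < 2 ^ m" "j < 2 ^ m"
  shows "A * q ^ (n - m) / 2 \<le> mass (cube (y + 2 ^ (n - m) *\<^sub>R grid_point i j) (2 ^ (n - m)))"
proof -
  define P where "P = (\<lambda>(i, j). cube (y + 2 ^ (n - m) *\<^sub>R grid_point i j) (2 ^ (n - m)))"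
  define I where "I = {..<2 ^ m::nat} \<times> {..<2 ^ m::nat}"
  have I: "finite I" "(i, j) \<in> I" "card I = 4 ^ m"
    using ij by (auto simp: I_def card_cartesian_product simp flip: power_mult_distrib)
  have "cube y (2 ^ n) \<subseteq> (\<Union>ij\<in>I. P ij)"
    using cube_subset_grid[of "2 ^ (n - m)" "2 ^ m" y] m
    by (simp add: I_def P_def flip: power_add)
  then have "mass (cube y (2 ^ n)) \<le> (\<Sum>ij\<in>I. mass (P ij))"
    by (intro loc_density_mass_le_sum[OF f_density I(1)]) (auto simp: P_def split: prod.splits)
  also have "\<dots> = mass (P (i, j)) + (\<Sum>ij\<in>I - {(i, j)}. mass (P ij))"
    by (rule sum.remove[OF I(1,2)])
  also have "(\<Sum>ij\<in>I - {(i, j)}. mass (P ij)) \<le> (\<Sum>ij\<in>I - {(i, j)}. A * q ^ (n - m))"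
    using smaller[of "n - m"] m by (intro sum_mono) (auto simp: P_def split: prod.splits)
  also have "\<dots> = (4 ^ m - 1) * (A * q ^ (n - m))"
    using I by (simp add: card_Diff_singleton of_nat_diff)
  finally have "A * q ^ n - (4 ^ m - 1) * (A * q ^ (n - m)) \<le> mass (P (i, j))"
    using large by simp
  moreover have "q ^ n = q ^ m * q ^ (n - m)" using m by (simp flip: power_add)
  moreover have "(1/2) * (A * q ^ (n - m)) \<le> (q ^ m - 4 ^ m + 1) * (A * q ^ (n - m))"
    using qm A q by (intro mult_right_mono) auto
  ultimately show ?thesis by (simp add: P_def algebra_simps)
qed

text \<open>
  All subcubes of side \<open>2 ^ (n - l)\<close> are heavy, which makes \<open>w\<close> small on average; but the central
  subcube of side \<open>2 ^ (n - 5)\<close> is heavy too, which makes \<open>w\<close> large on average. Up to constants the two bounds differ by a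
  factor \<open>q ^ (l - 5)\<close>. The level 5 is the first at which the subcube with corner at the centre \<open>z\<close> lies in
  the disc of radius \<open>2 ^ (n - 1) / 8\<close> about \<open>z\<close>.
\<close>
lemma growth_contradiction:
  assumes l: "5 \<le> l" "l \<le> n" and ql: "4 ^ l - 1/2 \<le> q ^ l" and q5: "4 ^ 5 - 1/2 \<le> q ^ 5"
    and big: "128 * C * (bump_integral + 128 * C) / c\<^sup>2 < 2 ^ (l - 5)"
  shows False
proof -
  define p where "p = n - l"
  define D where "D = bump_integral + 128 * C"
  have D: "0 \<le> D" using bump_integral_nonneg c by (simp add: D_def)
  have np: "n = p + l" using l by (simp add: p_def)
  define P where "P = (\<lambda>(i, j). cube (y + 2 ^ p *\<^sub>R grid_point i j) (2 ^ p))"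
  define I where "I = {..<2 ^ l::nat} \<times> {..<2 ^ l::nat}"
  have I: "finite I" "card I = 4 ^ l"
    by (auto simp: I_def card_cartesian_product simp flip: power_mult_distrib)
  have "cube y (2 ^ n) \<subseteq> (\<Union>ij\<in>I. P ij)"
    using cube_subset_grid[of "2 ^ p" "2 ^ l" y] np
    by (simp add: I_def P_def add.commute flip: power_add)
  then have "(LINT x:cube y (2 ^ n)|lborel. w x) \<le> (\<Sum>ij\<in>I. LINT x:P ij|lborel. w x)"
    by (intro loc_density_mass_le_sum[OF w_density I(1)]) (auto simp: P_def split: prod.splits)
  also have "\<dots> \<le> (\<Sum>ij\<in>I. 16 / c * 4 ^ p * (D * A * q ^ p))"
  proof (rule sum_mono)
    fix ij assume "ij \<in> I"
    then obtain i j where ij: "ij = (i, j)" "i < 2 ^ l" "j < 2 ^ l" by (auto simp: I_def)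
    have "A * q ^ p / 2 \<le> mass (P ij)"
      using subcube_mass_large[OF _ l(2) ql ij(2,3)] l by (simp add: P_def ij(1) p_def)
    then show "(LINT x:P ij|lborel. w x) \<le> 16 / c * 4 ^ p * (D * A * q ^ p)"
      using w_mass_le[of p] np l by (simp add: P_def ij(1) D_def)
  qed
  also have "\<dots> = 16 / c * 4 ^ n * (D * A * q ^ p)"
    using I by (simp add: np power_add)
  finally have w_total: "(LINT x:cube y (2 ^ n)|lborel. w x) \<le> 16 / c * 4 ^ n * (D * A * q ^ p)" .

  define z where "z = y + 2 ^ (n - 1) *\<^sub>R One"
  have n1: "(2::real) ^ n = 2 * 2 ^ (n - 1)" and n5: "(2::real) ^ n = 32 * 2 ^ (n - 5)"
    using l power_add[of "2::real" 1 "n - 1"] power_add[of "2::real" 5 "n - 5"] by auto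
  have "avg w (2 ^ (n - 1)) z \<le> C / (2 ^ (n - 1))\<^sup>2 * (LINT x:cube y (2 ^ n)|lborel. w x)"
    using ball_subset_cube[of y "2 ^ (n - 1)"] by (intro avg_le[OF w_density]) (auto simp: z_def n1)
  also have "\<dots> \<le> C / (2 ^ (n - 1))\<^sup>2 * (16 / c * 4 ^ n * (D * A * q ^ p))"
    using w_total c by (intro mult_left_mono) auto
  also have "\<dots> = 64 * C / c * D * A * q ^ p"
  proof -
    have "(4::real) ^ n = 4 * (2 ^ (n - 1))\<^sup>2"
    proof -
      have "(4::real) ^ n = (2 ^ n)\<^sup>2" by (simp add: power2_eq_square flip: power_mult_distrib)
      then show ?thesis unfolding n1 by (simp add: power_mult_distrib)
    qed
    then show ?thesis by simp
  qed
  finally have upper: "avg w (2 ^ (n - 1)) z \<le> 64 * C / c * D * A * q ^ p" .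

  have centre: "z = y + 2 ^ (n - 5) *\<^sub>R grid_point 16 16"
    using n1 n5 by (simp add: z_def vec_eq_iff forall_2 del: sum_component)
  have "A * q ^ (n - 5) / 2 \<le> mass (cube z (2 ^ (n - 5)))"
    unfolding centre by (rule subcube_mass_large) (use l q5 in auto)
  then have "c * (A * q ^ (n - 5) / 2) \<le> c * mass (cube z (2 ^ (n - 5)))"
    using c by simp
  also have "\<dots> \<le> avg w (2 ^ (n - 1)) z"
  proof (rule avg_ge_mass)
    have "z \<in> cube z (2 ^ (n - 5))" by (simp add: mem_cube)
    from cube_subset_cball[OF this]
    have "cube z (2 ^ (n - 5)) \<subseteq> cball z (2 * 2 ^ (n - 5))" .
    moreover have "2 * 2 ^ (n - 5) = (2::real) ^ (n - 1) / 8" using n1 n5 by linarith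
    ultimately show "cube z (2 ^ (n - 5)) \<subseteq> cball z (2 ^ (n - 1) / 8)" by metis
  qed auto
  also note upper
  finally have "A * (c * q ^ (n - 5)) \<le> A * (128 * C / c * D * q ^ p)" by (simp add: field_simps)
  then have "c * q ^ (n - 5) \<le> 128 * C / c * D * q ^ p"
    by (rule mult_left_le_imp_le) (use A in simp)
  moreover have "q ^ (n - 5) = q ^ (l - 5) * q ^ p" using l by (simp add: np add.commute flip: power_add)
  ultimately have "(c * q ^ (l - 5)) * q ^ p \<le> (128 * C / c * D) * q ^ p" by (simp add: mult.assoc)
  then have "c * q ^ (l - 5) \<le> 128 * C / c * D" by (rule mult_right_le_imp_le) (use q in simp)
  then have "q ^ (l - 5) \<le> 128 * C * D / c\<^sup>2" using c by (simp add: field_simps power2_eq_square)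
  moreover have "(2::real) ^ (l - 5) \<le> q ^ (l - 5)" using q by (intro power_mono) auto
  ultimately show False using big by (simp add: D_def)
qed

end

end

text \<open>
  The order of the choices matters: \<open>l\<close> depends only on the kernel, \<open>q\<close> on \<open>l\<close>, and \<open>A\<close> on \<open>B\<close> and \<open>l\<close>. The scales
  below \<open>l\<close>, too small to be subdivided \<open>l\<close> times, are covered by the trivial bound on \<open>f\<close>.
\<close>
lemma cube_mass_growth:
  obtains q A where "2 \<le> q" "q < 4" "1 \<le> A" "\<And>n y. mass (cube y (2 ^ n)) \<le> A * q ^ n"
proof -
  obtain k where k: "128 * C * (bump_integral + 128 * C) / c\<^sup>2 < 2 ^ k"
    using real_arch_pow[of 2] by auto
  define l where "l = k + 5"
  define q where "q = root l (4 ^ l - 1/2)"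
  have l: "0 < l" "5 \<le> l" by (auto simp: l_def)
  have half: "(1/2::real) \<le> 4 ^ l - 1/2" using one_le_power[of "4::real" l] by linarith
  have ql: "q ^ l = 4 ^ l - 1/2"
    unfolding q_def using half by (intro real_root_pow_pos2[OF l(1)]) linarith
  have q0: "0 \<le> q" unfolding q_def using half by (intro real_root_ge_zero) linarith
  have q4: "q < 4"
  proof (rule power_less_imp_less_base)
    show "q ^ l < 4 ^ l" using ql by simp
  qed simp
  have "(2::real) ^ l \<le> 4 ^ l - 1/2"
  proof -
    have "(2::real) * 2 ^ l \<le> 2 ^ l * 2 ^ l"
      using l self_le_power[of "2::real" l] by (intro mult_right_mono) auto
    also have "\<dots> = 4 ^ l" by (simp flip: power_mult_distrib)
    finally show ?thesis using one_le_power[of "2::real" l] by linarith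
  qed
  then have q2: "2 \<le> q" using power_le_imp_le_base[of 2 "l - 1" q] ql l q0 by simp
  have q5: "4 ^ 5 - 1/2 \<le> q ^ 5"
  proof -
    have "(q / 4) ^ l \<le> (q / 4) ^ 5" using l q0 q4 by (intro power_decreasing) auto
    moreover have "(q / 4) ^ l = 1 - 1 / (2 * 4 ^ l)" by (simp add: power_divide ql field_simps)
    moreover have "1 / (2 * 4 ^ l) \<le> 1 / (2 * (4::real) ^ 5)"
      using power_increasing[OF l(2), of "4::real"] by (intro divide_left_mono) auto
    ultimately have "1 - 1 / (2 * 4 ^ 5) \<le> (q / 4) ^ 5" by linarith
    then show ?thesis by (simp add: power_divide field_simps)
  qed
  define A where "A = max 1 (4 * B * 4 ^ l)"
  have "4 * B * 1 \<le> 4 * B * 4 ^ l" using B by (intro mult_left_mono one_le_power) auto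
  then have A: "1 \<le> A" "4 * B \<le> A" and AB: "B * 4 ^ l \<le> A"
    using B unfolding A_def by linarith+
  have "mass (cube y (2 ^ n)) \<le> A * q ^ n" for n y
  proof (induction n arbitrary: y rule: less_induct)
    case (less n)
    show ?case
    proof (cases "n < l")
      case True
      have "mass (cube y (2 ^ n)) \<le> B * (2 ^ n)\<^sup>2" by (rule mass_cube_le) simp
      also have "(2 ^ n)\<^sup>2 = (4::real) ^ n" by (simp add: power2_eq_square flip: power_mult_distrib)
      also have "B * 4 ^ n \<le> B * 4 ^ l" using True B by (intro mult_left_mono power_increasing) auto
      also have "\<dots> \<le> A * 1" using AB by simp
      also have "\<dots> \<le> A * q ^ n" using A q2 by (intro mult_left_mono one_le_power) auto
      finally show ?thesis .
    next
      case False
      show ?thesis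
      proof (rule ccontr)
        assume "\<not> ?thesis"
        then have "A * q ^ n < mass (cube y (2 ^ n))" by simp
        from growth_contradiction[OF q2 less_imp_le[OF q4] A less.IH this l(2) _ _ q5] show False
          using False ql k by (simp add: l_def)
      qed
    qed
  qed
  then show thesis using that q2 q4 A(1) by blast
qed

theorem mass_subquadratic:
  obtains \<epsilon> D where "0 < \<epsilon>" "\<And>R. 1 \<le> R \<Longrightarrow> mass (ball 0 R) \<le> D * R powr (2 - \<epsilon>)"
proof -
  obtain q A where q: "2 \<le> q" "q < 4" and A: "1 \<le> A" and bound: "\<And>n y. mass (cube y (2 ^ n)) \<le> A * q ^ n"
    using cube_mass_growth by blast
  define \<alpha> where "\<alpha> = log 2 q"
  have "\<alpha> < log 2 4" unfolding \<alpha>_def using q by (subst log_less_cancel_iff) auto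
  also have "log 2 (4::real) = 2" using log_pow_cancel[of "2::real" 2] by simp
  finally have \<alpha>2: "\<alpha> < 2" .
  have \<alpha>0: "0 \<le> \<alpha>" unfolding \<alpha>_def using q by simp
  have "mass (ball 0 R) \<le> (A * 4 powr \<alpha>) * R powr \<alpha>" if R: "1 \<le> R" for R
  proof -
    define n where "n = nat \<lceil>log 2 (2 * R)\<rceil>"
    have pos: "0 \<le> log 2 (2 * R)" using R by simp
    then have n: "log 2 (2 * R) \<le> real n" "real n \<le> log 2 (2 * R) + 1" by (auto simp: n_def)
    have lower: "2 * R \<le> 2 ^ n" using n(1) R by (simp add: log_le_iff powr_realpow)
    have "real n \<le> log 2 (4 * R)" using n(2) R log_mult[of 2 2 "2 * R"] by simp
    then have upper: "2 ^ n \<le> 4 * R" using R by (simp add: le_log_iff powr_realpow)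
    have sub: "ball 0 R \<subseteq> cube (- R *\<^sub>R One) (2 ^ n)"
    proof -
      have "ball 0 R \<subseteq> cube (- R *\<^sub>R One) (2 * R)"
        using ball_subset_cube[of "- R *\<^sub>R One" R] by simp
      moreover have "cube (- R *\<^sub>R One) (2 * R) \<subseteq> cube (- R *\<^sub>R One) (2 ^ n)"
      proof
        fix x assume "x \<in> cube (- R *\<^sub>R One) (2 * R)"
        then show "x \<in> cube (- R *\<^sub>R One) (2 ^ n)" unfolding mem_cube using lower by linarith
      qed
      ultimately show ?thesis by blast
    qed
    have "mass (ball 0 R) \<le> mass (cube (- R *\<^sub>R One) (2 ^ n))"
      by (rule loc_density_mass_mono[OF f_density _ _ _ sub]) auto
    also have "\<dots> \<le> A * q ^ n" by (rule bound)
    also have "q ^ n = (2 ^ n) powr \<alpha>"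
    proof -
      have "q ^ n = (2 powr \<alpha>) powr real n" using q by (simp add: \<alpha>_def powr_realpow)
      also have "\<dots> = (2 powr real n) powr \<alpha>" by (simp add: powr_powr mult.commute)
      also have "2 powr real n = (2::real) ^ n" by (simp add: powr_realpow)
      finally show ?thesis .
    qed
    also have "A * \<dots> \<le> A * (4 * R) powr \<alpha>"
      using A upper \<alpha>0 by (intro mult_left_mono powr_mono2) auto
    finally show ?thesis using R by (simp add: powr_mult mult.assoc)
  qed
  then show thesis using that[of "2 - \<alpha>" "A * 4 powr \<alpha>"] \<alpha>2 by simp
qed

end

section \<open>From the distributional equation to Borel densities\<close>

lemma locally_integrable_measurable:
  assumes "locally_integrable g"
  shows "g \<in> borel_measurable lebesgue"
proof (rule borel_measurable_LIMSEQ_real)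
  have "set_integrable lebesgue (cball 0 (real n)) g" for n
    using assms by (simp add: locally_integrable_def)
  then show "(\<lambda>x. indicator (cball 0 (real n)) x *\<^sub>R g x) \<in> borel_measurable lebesgue" for n
    using borel_measurable_integrable by (auto simp: set_integrable_def)
  show "(\<lambda>n. indicator (cball 0 (real n)) x *\<^sub>R g x) \<longlonglongrightarrow> g x" for x
  proof (rule tendsto_eventually)
    show "\<forall>\<^sub>F n in sequentially. indicator (cball 0 (real n)) x *\<^sub>R g x = g x"
      using eventually_ge_at_top[of "nat \<lceil>norm x\<rceil>"]
      by eventually_elim (auto simp: indicator_def)
  qed
qed

lemma integral_lebesgue_eq_lborel:
  fixes g g' :: "'a::euclidean_space \<Rightarrow> real"
  assumes m: "g \<in> borel_measurable lebesgue" and g': "g' \<in> borel_measurable borel"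
    and ae: "AE x in lborel. g x = g' x"
  shows "integrable lebesgue g \<longleftrightarrow> integrable lborel g'" "integral\<^sup>L lebesgue g = integral\<^sup>L lborel g'"
proof -
  have ae': "AE x in lebesgue. g x = g' x" using AE_completion[OF ae] .
  have m': "g' \<in> borel_measurable lebesgue" using g' by (simp add: measurable_completion)
  show "integrable lebesgue g \<longleftrightarrow> integrable lborel g'"
    using integrable_cong_AE[OF m m' ae'] integrable_completion[of g' lborel] g' by simp
  show "integral\<^sup>L lebesgue g = integral\<^sup>L lborel g'"
    using integral_cong_AE[OF m m' ae'] integral_completion[of g' lborel] g' by simp
qed

theorem theorem1p2:
  fixes K u :: "real^2 \<Rightarrow> real" and l L :: real
  assumes "K \<in> borel_measurable lebesgue"
    and "0 < l" and "\<And>x. l \<le> K x" and "\<And>x. K x \<le> L"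
    and "entire_solution K u"
    and "bdd_above (range u)"
  shows "\<exists>\<epsilon>>0. (\<lambda>R. LINT x:ball 0 R|lebesgue. exp (2 * u x)) \<in> O[at_top](\<lambda>R::real. R powr (2 - \<epsilon>))"
proof -
  obtain M where M: "\<And>x. u x \<le> M" using assms(6) by (auto simp: bdd_above_def)
  have L: "0 < L" using assms(2) assms(3)[of 0] assms(4)[of 0] by linarith
  have u_int: "locally_integrable u" using assms(5) by (simp add: entire_solution_def)
  have [measurable]: "u \<in> borel_measurable lebesgue" "K \<in> borel_measurable lebesgue"
    using locally_integrable_measurable[OF u_int] assms(1) by auto
  obtain u' K' where [measurable]: "u' \<in> borel_measurable borel" "K' \<in> borel_measurable borel"
    and ae': "AE x in lborel. u x = u' x" "AE x in lborel. K x = K' x"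
    using completion_ex_borel_measurable_real[of u lborel] completion_ex_borel_measurable_real[of K lborel] by auto
  define w where "w x = max 0 (M - u' x)" for x
  define B where "B = L * exp (2 * M)"
  \<comment> \<open>truncation makes the bounds on \<open>f\<close> hold everywhere, and changes it on a null set only\<close>
  define f where "f x = max 0 (min (K' x * exp (2 * u' x)) (B * exp (- 2 * w x)))" for x
  have w_meas [measurable]: "w \<in> borel_measurable borel"
    and f_meas [measurable]: "f \<in> borel_measurable borel"
    unfolding w_def f_def by measurable
  have ae_w: "AE x in lborel. u x = M - w x"
    using ae'(1) by eventually_elim (use M in \<open>simp add: w_def max_def, smt (verit)\<close>)
  have ae_f: "AE x in lborel. K x * exp (2 * u x) = f x"
    using ae' ae_w
  proof eventually_elim
    case (elim x)
    have "B * exp (- 2 * w x) = L * exp (2 * u x)"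
      using elim(3) by (simp add: B_def mult.assoc flip: exp_add)
    moreover have "K x * exp (2 * u x) \<le> L * exp (2 * u x)" using assms(4) by simp
    moreover have "0 \<le> K x * exp (2 * u x)" using assms(2) assms(3)[of x] by simp
    ultimately show ?case unfolding f_def using elim(1,2) by simp
  qed
  have w_loc: "loc_density w"
  proof (rule loc_densityI)
    fix r
    have "set_integrable lebesgue (cball 0 r) u"
      using u_int by (simp add: locally_integrable_def)
    moreover have "set_integrable lebesgue (cball 0 r) (\<lambda>_::real^2. M)"
      by (intro absolutely_integrable_on_const lmeasurable_cball)
    ultimately have int: "set_integrable lebesgue (cball 0 r) (\<lambda>x. M - u x)" by (intro set_integral_diff)
    then show "set_integrable lborel (cball 0 r) w"
      unfolding set_integrable_def
    proof (rule iffD1[OF integral_lebesgue_eq_lborel(1), rotated -1])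
      show "AE x in lborel. indicator (cball 0 r) x *\<^sub>R (M - u x) = indicator (cball 0 r) x *\<^sub>R w x"
        using ae_w by eventually_elim simp
      show "(\<lambda>x. indicator (cball 0 r) x *\<^sub>R w x) \<in> borel_measurable borel"
        by (intro borel_measurable_scaleR borel_measurable_indicator w_meas) simp
    qed (rule borel_measurable_integrable[OF int[unfolded set_integrable_def]])
  qed (auto simp: w_def)
  obtain a N :: "real \<Rightarrow> real" and c C where kernel:
    "0 < c" "c \<le> 1" "1 \<le> C" "\<And>t. isCont a t" "\<And>t. isCont N t"
    "\<And>t. 0 \<le> a t" "\<And>t. a t \<le> C" "\<And>t. 1 \<le> t \<Longrightarrow> a t = 0" "\<And>t. t \<le> 1/4 \<Longrightarrow> c \<le> a t"
    "\<And>t. 0 \<le> t \<Longrightarrow> 0 \<le> N t" "\<And>t. 0 \<le> t \<Longrightarrow> N t \<le> C"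
    "\<And>t. 1 \<le> t \<Longrightarrow> N t = 0" "\<And>t. 0 \<le> t \<Longrightarrow> t \<le> 1/64 \<Longrightarrow> c \<le> N t"
    and test: "\<And>(y::real^2) s. 0 < s \<Longrightarrow> test_fun (\<lambda>x. N ((norm (x - y) / s)\<^sup>2))"
    and lap: "\<And>(y::real^2) s x. 0 < s \<Longrightarrow> laplacian (\<lambda>x. N ((norm (x - y) / s)\<^sup>2)) x
        = a ((norm (x - y) / s)\<^sup>2) / s\<^sup>2 - a ((norm (x - y) / (s/2))\<^sup>2) / (s/2)\<^sup>2"
    by (rule telescoping_kernel) (rule that)
  interpret bump_average a c C by unfold_locales (fact kernel)+
  have N_meas [measurable]: "N \<in> borel_measurable borel"
    by (rule borel_measurable_continuous_onI) (simp add: kernel(5) continuous_at_imp_continuous_on)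
  interpret exponential_density a c C N w f B
  proof unfold_locales
    fix y :: "real^2" and s :: real assume s: "0 < s"
    let ?\<phi> = "\<lambda>x. N ((norm (x - y) / s)\<^sup>2)"
    let ?\<kappa> = "\<lambda>x. bump s y x - bump (s / 2) y x"
    have s2: "0 < s / 2" using s by simp
    have lap': "laplacian ?\<phi> = ?\<kappa>" using lap[OF s] by (auto simp: bump_def)
    have weak: "(LINT x|lebesgue. u x * ?\<kappa> x) + (LINT x|lebesgue. K x * exp (2 * u x) * ?\<phi> x) = 0"
    proof -
      have "\<forall>\<phi>. test_fun \<phi> \<longrightarrow> (LINT x|lebesgue. u x * laplacian \<phi> x)
          + (LINT x|lebesgue. K x * exp (2 * u x) * \<phi> x) = 0"
        using assms(5) by (simp add: entire_solution_def)
      from this[rule_format, OF test[OF s, of y]] show ?thesis by (simp only: lap')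
    qed
    have [measurable]: "?\<kappa> \<in> borel_measurable lebesgue" "?\<phi> \<in> borel_measurable lebesgue"
      by (rule measurable_completion, measurable)+
    have "(LINT x|lebesgue. u x * ?\<kappa> x) = (LINT x|lborel. (M - w x) * ?\<kappa> x)"
      by (rule integral_lebesgue_eq_lborel(2)) (use ae_w in \<open>auto elim: eventually_mono\<close>)
    also have "\<dots> = (LINT x|lborel. M * bump s y x - M * bump (s / 2) y x
        - (w x * bump s y x - w x * bump (s / 2) y x))"
      by (intro Bochner_Integration.integral_cong) (auto simp: algebra_simps)
    \<comment> \<open>the constant \<open>M\<close> drops out, as the bump has the same integral at every scale\<close>
    also have "\<dots> = - (avg w s y - avg w (s / 2) y)"
      using bump_integrable[OF s, of y] bump_integrable[OF s2, of y]
        avg_integrable[OF w_loc s, of y] avg_integrable[OF w_loc s2, of y]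
        integral_bump[OF s, of y] integral_bump[OF s2, of y]
      by (simp add: avg_def)
    finally have 1: "(LINT x|lebesgue. u x * ?\<kappa> x) = - (avg w s y - avg w (s / 2) y)" .
    have "(LINT x|lebesgue. K x * exp (2 * u x) * ?\<phi> x) = (LINT x|lborel. f x * ?\<phi> x)"
      by (rule integral_lebesgue_eq_lborel(2)) (use ae_f in \<open>auto elim: eventually_mono\<close>)
    then show "avg w s y - avg w (s / 2) y = (LINT x|lborel. f x * ?\<phi> x)"
      using weak 1 by simp
  qed (use kernel w_loc L in \<open>auto simp: f_def B_def\<close>)
  obtain \<epsilon> D where \<epsilon>: "0 < \<epsilon>" and D: "\<And>R. 1 \<le> R \<Longrightarrow> mass (ball 0 R) \<le> D * R powr (2 - \<epsilon>)"
    using mass_subquadratic by blast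
  have bound: "(LINT x:ball 0 R|lebesgue. exp (2 * u x)) \<le> 1 / l * mass (ball 0 R)" for R
  proof -
    let ?g = "\<lambda>x. indicator (ball 0 R) x *\<^sub>R exp (2 * (M - w x))"
    have int_f: "integrable lborel (\<lambda>x. 1 / l * (indicator (ball 0 R) x *\<^sub>R f x))"
      using f_integrable_on_bounded[of "ball 0 R"] by (auto simp: set_integrable_def)
    have le: "AE x in lborel. ?g x \<le> 1 / l * (indicator (ball 0 R) x *\<^sub>R f x)"
      using ae_w ae_f
    proof eventually_elim
      case (elim x)
      have "l * exp (2 * u x) \<le> f x" using assms(3)[of x] unfolding elim(2)[symmetric] by simp
      then show ?case using assms(2) elim(1) by (auto simp: indicator_def field_simps)
    qed
    have g_meas: "?g \<in> borel_measurable borel"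
      by (intro borel_measurable_scaleR borel_measurable_indicator) (simp, measurable)
    have int_g: "integrable lborel ?g"
    proof (rule Bochner_Integration.integrable_bound[OF int_f])
      show "AE x in lborel. norm (?g x) \<le> norm (1 / l * (indicator (ball 0 R) x *\<^sub>R f x))"
        using le
      proof eventually_elim
        case (elim x)
        moreover have "0 \<le> ?g x" by simp
        ultimately show ?case unfolding real_norm_def by linarith
      qed
    qed (use g_meas in simp)
    have "(LINT x:ball 0 R|lebesgue. exp (2 * u x)) = (LINT x|lborel. ?g x)"
      unfolding set_lebesgue_integral_def
    proof (rule integral_lebesgue_eq_lborel(2)[OF _ g_meas])
      show "(\<lambda>x. indicator (ball 0 R) x *\<^sub>R exp (2 * u x)) \<in> borel_measurable lebesgue"
        by (intro borel_measurable_scaleR borel_measurable_indicator) (simp, measurable)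
      show "AE x in lborel. indicator (ball 0 R) x *\<^sub>R exp (2 * u x) = ?g x"
        using ae_w by eventually_elim simp
    qed
    also have "\<dots> \<le> (LINT x|lborel. 1 / l * (indicator (ball 0 R) x *\<^sub>R f x))"
      by (rule integral_mono_AE[OF int_g int_f le])
    finally show ?thesis by (simp add: set_lebesgue_integral_def)
  qed
  have "(\<lambda>R. LINT x:ball 0 R|lebesgue. exp (2 * u x)) \<in> O[at_top](\<lambda>R::real. R powr (2 - \<epsilon>))"
  proof (rule bigoI)
    show "\<forall>\<^sub>F R in at_top. norm (LINT x:ball 0 R|lebesgue. exp (2 * u x)) \<le> D / l * norm (R powr (2 - \<epsilon>))"
      using eventually_ge_at_top[of 1]
    proof eventually_elim
      case (elim R)
      have "0 \<le> (LINT x:ball 0 R|lebesgue. exp (2 * u x))"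
        unfolding set_lebesgue_integral_def by (rule Bochner_Integration.integral_nonneg) simp
      moreover have "1 / l * mass (ball 0 R) \<le> 1 / l * (D * R powr (2 - \<epsilon>))"
        using D[OF elim] assms(2) by (intro mult_left_mono) auto
      ultimately show ?case using bound[of R] by simp
    qed
  qed
  then show ?thesis using \<epsilon> by blast
qed

end
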